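(* Assume that $f$ is $\mu$-quasi strongly convex, $\mu\ge0$, and the functions $f_{ij}$ are convex and $L$-smooth for all $i\in\{1,\dots,n\}$, $j\in\{1,\dots,m\}$. Consider D-LSVRG with delay $\tau\ge1$, $p\in(0,1)$ and $$0<\gamma\le\min\left\{\frac3{56L},\ \frac1{8L\sqrt{\tau\left(2+\tau+\frac4{1-p}\right)}}\right\}.$$ Then D-LSVRG satisfies the parametric assumption of the context with $A'=2L$, $B_1'=0$, $B_2'=2$, $D_1'=0$, $\sigma_{2,k}^2=\sigma_k^2=\frac1{nm}\sum_{i=1}^n\sum_{j=1}^m\|\nabla f_{ij}(w_i^k)-\nabla f_{ij}(x^* )\|^2$, $\sigma_{1,k}^2\equiv0$, $\rho_1=1$, $\rho_2=p$, $C_1=0$, $C_2=Lp$, $D_2=0$, $G=0$, $F_1=0$, $F_2=\frac{12\gamma^2L\tau(2+p)}p$, $D_3=0$. Moreover, with $M_2=\frac8{3p}$ and $T^0=\|x^0-x^*\|^2+M_2\gamma^2\sigma_0^2$, for all $K\ge0$ $$\mathbf E[f(\bar x^K)-f(x^* )]\le\left(1-\min\left\{\frac{\gamma\mu}2,\frac p4\right\}\right)^K\frac{4(T^0+\gamma F_2\sigma_0^2)}\gamma$$ when $\mu>0$, and $$\mathbf E[f(\bar x^K)-f(x^* )]\le\frac{4(T^0+\gamma F_2\sigma_0^2)}{\gamma K}$$ when $\mu=0$ (right-hand side read as $+\infty$ for $K=0$).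
   Context: $f(x)=\frac1n\sum_{i=1}^nf_i(x)$, $f_i(x)=\frac1m\sum_{j=1}^mf_{ij}(x)$ on $\mathbb R^d$. A function is $L$-smooth if it is differentiable with $L$-Lipschitz gradient. $f$ is $\mu$-quasi strongly convex if it has a unique minimizer $x^*$ and $f(x^* )\ge f(x)+\langle\nabla f(x),x^*-x\rangle+\frac\mu2\|x-x^*\|^2$ for all $x$. All random choices use fresh independent randomness. Delayed framework with integer delay $\tau\ge1$: $x^{k+1}=x^k-\frac1n\sum_iv_i^k$, where $v_i^k=\gamma g_i^{k-\tau}$ if $k\ge\tau$ and $v_i^k=0$ if $k<\tau$; $e_i^{k+1}=e_i^k+\gamma g_i^k-v_i^k$, $e_i^0=0$; $x^0$ deterministic. Here $g_i^k$ is the stochastic vector associated with the point $x^k$. D-LSVRG: given deterministic $w_i^0\in\mathbb R^d$; for $k\ge0$ worker $i$ picks $l$ uniformly from $\{1,\dots,m\}$, sets $g_i^k=\nabla f_{il}(x^k)-\nabla f_{il}(w_i^k)+\nabla f_i(w_i^k)$, and $w_i^{k+1}=x^k$ with probability $p$, $w_i^{k+1}=w_i^k$ with probability $1-p$. Parametric assumption: let $g^k=\frac1n\sum_ig_i^k$, $e^k=\frac1n\sum_ie_i^k$, $\mathbf E_k$ the conditional expectation given $x^k$ and all randomness used to generate $g_i^t,w_i^{t+1}$ for $t<k$. For all $k,K\ge0$: $\mathbf E_k[g^k]=\nabla f(x^k)$; $\mathbf E_k\|g^k\|^2\le2A'(f(x^k)-f(x^* ))+B_1'\sigma_{1,k}^2+B_2'\sigma_{2,k}^2+D_1'$;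 $\mathbf E_k[\sigma_{1,k+1}^2]\le(1-\rho_1)\sigma_{1,k}^2+2C_1(f(x^k)-f(x^* ))+G\rho_1\sigma_{2,k}^2+D_2$; $\mathbf E_k[\sigma_{2,k+1}^2]\le(1-\rho_2)\sigma_{2,k}^2+2C_2(f(x^k)-f(x^* ))$; $3L\sum_{k=0}^Kw_k\mathbf E\|e^k\|^2\le\frac14\sum_{k=0}^Kw_k\mathbf E[f(x^k)-f(x^* )]+F_1\sigma_{1,0}^2+F_2\sigma_{2,0}^2+\gamma D_3W_K$, where (scalar weights) $w_k=(1-\eta)^{-(k+1)}$, $W_K=\sum_{k=0}^Kw_k$, $\eta=\min\{\frac{\gamma\mu}2,\frac{\rho_1}4,\frac{\rho_2}4\}$. Also $\bar x^K=\frac1{W_K}\sum_{k=0}^Kw_kx^k$. *)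

theory Defs
  imports "HOL-Probability.Probability"
begin

definition gradient :: "('a::euclidean_space \<Rightarrow> real) \<Rightarrow> 'a \<Rightarrow> 'a" where
  "gradient f x = (THE D. GDERIV f x :> D)"

definition L_smooth :: "real \<Rightarrow> ('a::euclidean_space \<Rightarrow> real) \<Rightarrow> bool" where
  "L_smooth L f \<longleftrightarrow> (\<forall>x. f differentiable (at x)) \<and> L-lipschitz_on UNIV (gradient f)"

text \<open>The first conjunct says that the set of global minimizers of \<open>f\<close> is exactly \<open>{xs}\<close>.\<close>

definition quasi_strongly_convex ::
  "real \<Rightarrow> ('a::euclidean_space \<Rightarrow> real) \<Rightarrow> 'a \<Rightarrow> bool" where
  "quasi_strongly_convex \<mu> f xs \<longleftrightarrow>
     (\<forall>y. (\<forall>x. f y \<le> f x) \<longleftrightarrow> y = xs) \<and>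
     (\<forall>x. f xs \<ge> f x + gradient f x \<bullet> (xs - x) + \<mu> / 2 * (norm (x - xs))\<^sup>2)"

definition local_loss ::
  "nat \<Rightarrow> (nat \<Rightarrow> nat \<Rightarrow> 'a::euclidean_space \<Rightarrow> real) \<Rightarrow> nat \<Rightarrow> 'a \<Rightarrow> real" where
  "local_loss m fc i y = (1 / real m) * (\<Sum>j=1..m. fc i j y)"

definition global_loss ::
  "nat \<Rightarrow> nat \<Rightarrow> (nat \<Rightarrow> nat \<Rightarrow> 'a::euclidean_space \<Rightarrow> real) \<Rightarrow> 'a \<Rightarrow> real" where
  "global_loss n m fc y = (1 / real n) * (\<Sum>i=1..n. local_loss m fc i y)"

text \<open>Processes are indexed by worker, iteration and outcome; workers are \<open>1..n\<close>.\<close>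

definition worker_mean ::
  "nat \<Rightarrow> (nat \<Rightarrow> nat \<Rightarrow> 'w \<Rightarrow> 'a::euclidean_space) \<Rightarrow> nat \<Rightarrow> 'w \<Rightarrow> 'a" where
  "worker_mean n h k \<omega> = (1 / real n) *\<^sub>R (\<Sum>i=1..n. h i k \<omega>)"

definition delayed_method ::
  "'w measure \<Rightarrow> nat \<Rightarrow> nat \<Rightarrow> real \<Rightarrow> 'a::euclidean_space \<Rightarrow>
   (nat \<Rightarrow> 'w \<Rightarrow> 'a) \<Rightarrow> (nat \<Rightarrow> nat \<Rightarrow> 'w \<Rightarrow> 'a) \<Rightarrow> (nat \<Rightarrow> nat \<Rightarrow> 'w \<Rightarrow> 'a) \<Rightarrow>
   (nat \<Rightarrow> nat \<Rightarrow> 'w \<Rightarrow> 'a) \<Rightarrow> bool" where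
  "delayed_method M n \<tau> \<gamma> x0 x g v e \<longleftrightarrow>
     (\<forall>\<omega>\<in>space M.
        x 0 \<omega> = x0 \<and>
        (\<forall>k. x (Suc k) \<omega> = x k \<omega> - worker_mean n v k \<omega>) \<and>
        (\<forall>i\<in>{1..n}.
           e i 0 \<omega> = 0 \<and>
           (\<forall>k. v i k \<omega> = (if k \<ge> \<tau> then \<gamma> *\<^sub>R g i (k - \<tau>) \<omega> else 0)) \<and>
           (\<forall>k. e i (Suc k) \<omega> = e i k \<omega> + \<gamma> *\<^sub>R g i k \<omega> - v i k \<omega>)))"

text \<open>\<open>idx i k\<close> is the component index drawn by worker \<open>i\<close> at iteration \<open>k\<close>, and
  \<open>coin i k\<close> decides whether it refreshes its reference point.  All these variables are
  mutually independent: the pairs are independent over workers and iterations, and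
  the law of each pair is a product.\<close>

definition fresh_randomness ::
  "'w measure \<Rightarrow> nat \<Rightarrow> nat \<Rightarrow> real \<Rightarrow> (nat \<Rightarrow> nat \<Rightarrow> 'w \<Rightarrow> nat) \<Rightarrow>
   (nat \<Rightarrow> nat \<Rightarrow> 'w \<Rightarrow> bool) \<Rightarrow> bool" where
  "fresh_randomness M n m p idx coin \<longleftrightarrow>
     prob_space M \<and>
     prob_space.indep_vars M (\<lambda>_. count_space UNIV)
       (\<lambda>(i, k) \<omega>. (idx i k \<omega>, coin i k \<omega>)) ({1..n} \<times> UNIV) \<and>
     (\<forall>i\<in>{1..n}. \<forall>k.
        distr M (count_space UNIV) (\<lambda>\<omega>. (idx i k \<omega>, coin i k \<omega>)) =
        measure_pmf (pair_pmf (pmf_of_set {1..m}) (bernoulli_pmf p)))"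

definition lsvrg_estimator ::
  "'w measure \<Rightarrow> nat \<Rightarrow> nat \<Rightarrow> (nat \<Rightarrow> nat \<Rightarrow> 'a::euclidean_space \<Rightarrow> real) \<Rightarrow> (nat \<Rightarrow> 'a) \<Rightarrow>
   (nat \<Rightarrow> nat \<Rightarrow> 'w \<Rightarrow> nat) \<Rightarrow> (nat \<Rightarrow> nat \<Rightarrow> 'w \<Rightarrow> bool) \<Rightarrow>
   (nat \<Rightarrow> 'w \<Rightarrow> 'a) \<Rightarrow> (nat \<Rightarrow> nat \<Rightarrow> 'w \<Rightarrow> 'a) \<Rightarrow> (nat \<Rightarrow> nat \<Rightarrow> 'w \<Rightarrow> 'a) \<Rightarrow> bool" where
  "lsvrg_estimator M n m fc w0 idx coin x w g \<longleftrightarrow>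
     (\<forall>\<omega>\<in>space M. \<forall>i\<in>{1..n}.
        w i 0 \<omega> = w0 i \<and>
        (\<forall>k. g i k \<omega> = gradient (fc i (idx i k \<omega>)) (x k \<omega>)
                       - gradient (fc i (idx i k \<omega>)) (w i k \<omega>)
                       + gradient (local_loss m fc i) (w i k \<omega>)) \<and>
        (\<forall>k. w i (Suc k) \<omega> = (if coin i k \<omega> then x k \<omega> else w i k \<omega>)))"

definition dlsvrg ::
  "'w measure \<Rightarrow> nat \<Rightarrow> nat \<Rightarrow> (nat \<Rightarrow> nat \<Rightarrow> 'a::euclidean_space \<Rightarrow> real) \<Rightarrow>
   nat \<Rightarrow> real \<Rightarrow> real \<Rightarrow> 'a \<Rightarrow> (nat \<Rightarrow> 'a) \<Rightarrow>
   (nat \<Rightarrow> nat \<Rightarrow> 'w \<Rightarrow> nat) \<Rightarrow> (nat \<Rightarrow> nat \<Rightarrow> 'w \<Rightarrow> bool) \<Rightarrow>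
   (nat \<Rightarrow> 'w \<Rightarrow> 'a) \<Rightarrow> (nat \<Rightarrow> nat \<Rightarrow> 'w \<Rightarrow> 'a) \<Rightarrow> (nat \<Rightarrow> nat \<Rightarrow> 'w \<Rightarrow> 'a) \<Rightarrow>
   (nat \<Rightarrow> nat \<Rightarrow> 'w \<Rightarrow> 'a) \<Rightarrow> (nat \<Rightarrow> nat \<Rightarrow> 'w \<Rightarrow> 'a) \<Rightarrow> bool" where
  "dlsvrg M n m fc \<tau> \<gamma> p x0 w0 idx coin x w g v e \<longleftrightarrow>
     fresh_randomness M n m p idx coin \<and>
     delayed_method M n \<tau> \<gamma> x0 x g v e \<and>
     lsvrg_estimator M n m fc w0 idx coin x w g"

text \<open>The argument \<open>y\<close> is a tuple of reference points, one per worker.\<close>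

definition lsvrg_sigma_sq ::
  "nat \<Rightarrow> nat \<Rightarrow> (nat \<Rightarrow> nat \<Rightarrow> 'a::euclidean_space \<Rightarrow> real) \<Rightarrow> 'a \<Rightarrow> (nat \<Rightarrow> 'a) \<Rightarrow> real" where
  "lsvrg_sigma_sq n m fc xs y =
     (1 / (real n * real m)) *
     (\<Sum>i=1..n. \<Sum>j=1..m. (norm (gradient (fc i j) (y i) - gradient (fc i j) xs))\<^sup>2)"

definition history ::
  "'w measure \<Rightarrow> nat \<Rightarrow> (nat \<Rightarrow> 'w \<Rightarrow> 'a::euclidean_space) \<Rightarrow>
   (nat \<Rightarrow> nat \<Rightarrow> 'w \<Rightarrow> nat) \<Rightarrow> (nat \<Rightarrow> nat \<Rightarrow> 'w \<Rightarrow> bool) \<Rightarrow> nat \<Rightarrow> 'w measure" where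
  "history M n x idx coin k = sigma (space M)
     ({x k -` B \<inter> space M | B. B \<in> sets borel} \<union>
      {idx i t -` J \<inter> space M | i t J. i \<in> {1..n} \<and> t < k} \<union>
      {coin i t -` H \<inter> space M | i t H. i \<in> {1..n} \<and> t < k})"

definition vec_cond_exp ::
  "'w measure \<Rightarrow> 'w measure \<Rightarrow> ('w \<Rightarrow> 'a::euclidean_space) \<Rightarrow> 'w \<Rightarrow> 'a" where
  "vec_cond_exp M F X \<omega> = (\<Sum>b\<in>Basis. real_cond_exp M F (\<lambda>\<omega>. X \<omega> \<bullet> b) \<omega> *\<^sub>R b)"

record parametric_constants =
  cA :: real
  cB1 :: real
  cB2 :: real
  cD1 :: real
  crho1 :: real
  crho2 :: real
  cC1 :: real
  cC2 :: real
  cD2 :: real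
  cG :: real
  cF1 :: real
  cF2 :: real
  cD3 :: real

definition eta :: "real \<Rightarrow> real \<Rightarrow> parametric_constants \<Rightarrow> real" where
  "eta \<gamma> \<mu> c = min (\<gamma> * \<mu> / 2) (min (crho1 c / 4) (crho2 c / 4))"

definition weight :: "real \<Rightarrow> nat \<Rightarrow> real" where
  "weight \<eta> k = 1 / (1 - \<eta>) ^ (k + 1)"

definition weight_sum :: "real \<Rightarrow> nat \<Rightarrow> real" where
  "weight_sum \<eta> K = (\<Sum>k=0..K. weight \<eta> k)"

definition weighted_iterate ::
  "real \<Rightarrow> (nat \<Rightarrow> 'w \<Rightarrow> 'a::euclidean_space) \<Rightarrow> nat \<Rightarrow> 'w \<Rightarrow> 'a" where
  "weighted_iterate \<eta> x K \<omega> = (1 / weight_sum \<eta> K) *\<^sub>R (\<Sum>k=0..K. weight \<eta> k *\<^sub>R x k \<omega>)"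

text \<open>Here \<open>F k\<close> is the sigma-algebra conditioned on at iteration \<open>k\<close>, \<open>g\<close> and \<open>e\<close> are the
  averages over the workers, and \<open>s1 k\<close>, \<open>s2 k\<close> are the (random) squared quantities
  sigma_{1,k}^2 and sigma_{2,k}^2.  The subalgebra and integrability conjuncts only ensure
  that the (conditional) expectations below are genuine, since the library operators take
  default values otherwise.\<close>

definition parametric_assumption ::
  "'w measure \<Rightarrow> (nat \<Rightarrow> 'w measure) \<Rightarrow> ('a::euclidean_space \<Rightarrow> real) \<Rightarrow> 'a \<Rightarrow>
   real \<Rightarrow> real \<Rightarrow> real \<Rightarrow> parametric_constants \<Rightarrow>
   (nat \<Rightarrow> 'w \<Rightarrow> 'a) \<Rightarrow> (nat \<Rightarrow> 'w \<Rightarrow> 'a) \<Rightarrow> (nat \<Rightarrow> 'w \<Rightarrow> 'a) \<Rightarrow>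
   (nat \<Rightarrow> 'w \<Rightarrow> real) \<Rightarrow> (nat \<Rightarrow> 'w \<Rightarrow> real) \<Rightarrow> bool" where
  "parametric_assumption M F f xs L \<mu> \<gamma> c x g e s1 s2 \<longleftrightarrow>
     (\<forall>k. subalgebra M (F k) \<and>
          integrable M (g k) \<and> integrable M (\<lambda>\<omega>. (norm (g k \<omega>))\<^sup>2) \<and>
          integrable M (\<lambda>\<omega>. (norm (e k \<omega>))\<^sup>2) \<and>
          integrable M (\<lambda>\<omega>. f (x k \<omega>) - f xs) \<and>
          integrable M (s1 k) \<and> integrable M (s2 k)) \<and>
     (\<forall>k. AE \<omega> in M. vec_cond_exp M (F k) (g k) \<omega> = gradient f (x k \<omega>)) \<and>
     (\<forall>k. AE \<omega> in M. real_cond_exp M (F k) (\<lambda>\<omega>. (norm (g k \<omega>))\<^sup>2) \<omega>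
            \<le> 2 * cA c * (f (x k \<omega>) - f xs) + cB1 c * s1 k \<omega> + cB2 c * s2 k \<omega> + cD1 c) \<and>
     (\<forall>k. AE \<omega> in M. real_cond_exp M (F k) (s1 (Suc k)) \<omega>
            \<le> (1 - crho1 c) * s1 k \<omega> + 2 * cC1 c * (f (x k \<omega>) - f xs)
               + cG c * crho1 c * s2 k \<omega> + cD2 c) \<and>
     (\<forall>k. AE \<omega> in M. real_cond_exp M (F k) (s2 (Suc k)) \<omega>
            \<le> (1 - crho2 c) * s2 k \<omega> + 2 * cC2 c * (f (x k \<omega>) - f xs)) \<and>
     (\<forall>K. AE \<omega> in M.
        3 * L * (\<Sum>k=0..K. weight (eta \<gamma> \<mu> c) k * (\<integral>\<omega>'. (norm (e k \<omega>'))\<^sup>2 \<partial>M))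
          \<le> 1 / 4 * (\<Sum>k=0..K. weight (eta \<gamma> \<mu> c) k * (\<integral>\<omega>'. (f (x k \<omega>') - f xs) \<partial>M))
             + cF1 c * s1 0 \<omega> + cF2 c * s2 0 \<omega> + \<gamma> * cD3 c * weight_sum (eta \<gamma> \<mu> c) K)"

end

theory Submission
  imports Defs
begin

text \<open>
  Both rates come from a Lyapunov argument along the virtual iterates
  \<open>y\<^sup>k = x\<^sup>k - e\<^sup>k\<close>. Delay cancels in them: \<open>y\<^sup>k\<^sup>+\<^sup>1 = y\<^sup>k - \<gamma> g\<^sup>k\<close>, so they perform undelayed
  stochastic gradient steps, with the gradient taken at the wrong point \<open>x\<^sup>k\<close>. Quasi strong
  convexity and \<open>\<parallel>\<nabla>f(x)\<parallel>\<^sup>2 \<le> 2L(f(x) - f(x\<^sup>*))\<close> turn this mismatch into the price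
  \<open>3L\<gamma>\<parallel>e\<^sup>k\<parallel>\<^sup>2\<close> (\<open>virtual_step\<close>). Adding the multiple \<open>8\<gamma>\<^sup>2/(3p)\<close> of \<open>\<sigma>\<^sub>k\<^sup>2\<close> absorbs the variance of the
  estimator and gives the one-step descent \<open>T_step\<close>. Multiplied by the weights \<open>w\<^sub>k\<close> it telescopes,
  and Jensen's inequality passes to the averaged iterate.

  The conditional moment bounds are those of LSVRG. The term
  \<open>\<nabla>f\<^sub>i\<^sub>l(w\<^sub>i) - \<nabla>f\<^sub>i(w\<^sub>i)\<close> of the estimator is centred, so that it costs at most the second moment
  \<open>\<sigma>\<^sup>2\<close> of \<open>\<nabla>f\<^sub>i\<^sub>l(w\<^sub>i) - \<nabla>f\<^sub>i\<^sub>l(x\<^sup>*)\<close>, while convexity and smoothness bound the remaining part by the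
  gap \<open>f(x) - f(x\<^sup>*)\<close> (\<open>gradient_gap_le_bregman\<close>, \<open>estimator_second_moment\<close>).

  The main point is the bound on \<open>e\<^sup>k\<close>, which is \<open>\<gamma>\<close> times the sum of the last \<open>\<tau>\<close> estimators.
  Splitting each into its conditional mean and a martingale difference costs a factor two,
  but only the means pay for the length of the window: the squared norm of the noise sum is,
  in expectation, the sum of the squared norms (\<open>expectation_noise_sum\<close>). The resulting window
  sums are compared with plain weighted sums. Since \<open>\<eta>\<tau> \<le> 1/16\<close>, the weight changes by at most
  the factor \<open>16/15\<close> within a window (\<open>weighted_sum_window_le\<close>), and the contraction of
  \<open>\<sigma>\<^sub>k\<^sup>2\<close> bounds its weighted sum by \<open>\<sigma>\<^sub>0\<^sup>2\<close> and the weighted sum of the gaps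
  (\<open>weighted_sum_contraction\<close>). The step size
  condition leaves at most a quarter of the gaps (\<open>weighted_error\<close>).

  Measure-theoretic side conditions are settled at once. The random draws are discrete and
  almost surely take finitely many values, and so does every quantity computed from finitely
  many of them. Such quantities are closed under arbitrary functions and are integrable.
\<close>

section \<open>Gradients of smooth convex functions\<close>

lemma GDERIV_unique:
  assumes "GDERIV f x :> D" and "GDERIV f x :> D'"
  shows "D = D'"
proof -
  have "(\<lambda>h. h \<bullet> D) = (\<lambda>h. h \<bullet> D')"
    using assms unfolding gderiv_def by (rule has_derivative_unique)
  then show ?thesis by (metis vector_eq_ldot)
qed

lemma gradient_eqI: "GDERIV f x :> D \<Longrightarrow> gradient f x = D"
  unfolding gradient_def by (blast intro: GDERIV_unique)

lemma GDERIV_gradient: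
  fixes f :: "'a::euclidean_space \<Rightarrow> real"
  assumes "f differentiable (at x)"
  shows "GDERIV f x :> gradient f x"
proof -
  obtain D where D: "(f has_derivative D) (at x)"
    using assms unfolding differentiable_def by blast
  interpret D: bounded_linear D using D by (rule has_derivative_bounded_linear)
  have "D h = h \<bullet> (\<Sum>b\<in>Basis. D b *\<^sub>R b)" for h
  proof -
    have "D h = D (\<Sum>b\<in>Basis. (h \<bullet> b) *\<^sub>R b)" by (simp add: euclidean_representation)
    also have "\<dots> = (\<Sum>b\<in>Basis. (h \<bullet> b) * D b)" by (simp add: D.sum D.scaleR)
    also have "\<dots> = h \<bullet> (\<Sum>b\<in>Basis. D b *\<^sub>R b)"
      by (simp add: inner_sum_right mult.commute)
    finally show ?thesis .
  qed
  then have "D = (\<lambda>h. h \<bullet> (\<Sum>b\<in>Basis. D b *\<^sub>R b))" by blast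
  then have "GDERIV f x :> (\<Sum>b\<in>Basis. D b *\<^sub>R b)"
    using D unfolding gderiv_def by metis
  then show ?thesis by (simp add: gradient_eqI)
qed

lemma GDERIV_sum:
  assumes "\<And>i. i \<in> I \<Longrightarrow> GDERIV (f i) x :> D i"
  shows "GDERIV (\<lambda>y. \<Sum>i\<in>I. f i y) x :> (\<Sum>i\<in>I. D i)"
  using assms unfolding gderiv_def by (auto simp: inner_sum_right intro!: has_derivative_sum)

lemma GDERIV_cmult:
  assumes "GDERIV f x :> D"
  shows "GDERIV (\<lambda>y. c * f y) x :> c *\<^sub>R D"
  using has_derivative_mult_right[OF assms[unfolded gderiv_def], of c]
  unfolding gderiv_def by (simp add: mult.commute)

text \<open>Restriction to a line, where the one-dimensional mean value and tangent theorems apply.\<close>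

lemma GDERIV_along_line:
  fixes f :: "'a::euclidean_space \<Rightarrow> real"
  assumes "\<And>z. f differentiable (at z)"
  shows "((\<lambda>t. f (x + t *\<^sub>R h)) has_real_derivative gradient f (x + t *\<^sub>R h) \<bullet> h) (at t)"
proof -
  have "((\<lambda>t. x + t *\<^sub>R h) has_derivative (\<lambda>s. s *\<^sub>R h)) (at t)"
    by (auto intro!: derivative_eq_intros)
  from has_derivative_compose[OF this GDERIV_gradient[OF assms, unfolded gderiv_def]]
  have "((\<lambda>t. f (x + t *\<^sub>R h)) has_derivative (\<lambda>s. s *\<^sub>R h \<bullet> gradient f (x + t *\<^sub>R h))) (at t)" .
  also have "(\<lambda>s. s *\<^sub>R h \<bullet> gradient f (x + t *\<^sub>R h)) = (*) (gradient f (x + t *\<^sub>R h) \<bullet> h)"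
    by (auto simp: inner_commute)
  finally show ?thesis by (simp add: has_field_derivative_def)
qed

lemma L_smooth_upper_bound:
  fixes f :: "'a::euclidean_space \<Rightarrow> real"
  assumes "L_smooth L f"
  shows "f y \<le> f x + gradient f x \<bullet> (y - x) + L / 2 * (norm (y - x))\<^sup>2"
proof -
  define h where "h = y - x"
  have diff: "\<And>z. f differentiable (at z)" and lip: "L-lipschitz_on UNIV (gradient f)"
    using assms unfolding L_smooth_def by auto
  define \<phi> where "\<phi> t = f (x + t *\<^sub>R h) - t * (gradient f x \<bullet> h) - L / 2 * t\<^sup>2 * (norm h)\<^sup>2" for t
  have deriv: "(\<phi> has_real_derivative
      gradient f (x + t *\<^sub>R h) \<bullet> h - gradient f x \<bullet> h - L * t * (norm h)\<^sup>2) (at t)" for t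
    unfolding \<phi>_def
    by (rule derivative_eq_intros GDERIV_along_line diff refl | simp add: algebra_simps)+
  have "\<phi> 1 \<le> \<phi> 0"
  proof (rule DERIV_nonpos_imp_nonincreasing[of 0 1 \<phi>])
    fix t :: real assume t: "0 \<le> t" "t \<le> 1"
    have "(gradient f (x + t *\<^sub>R h) - gradient f x) \<bullet> h
        \<le> norm (gradient f (x + t *\<^sub>R h) - gradient f x) * norm h"
      by (rule norm_cauchy_schwarz)
    also have "\<dots> \<le> (L * norm (t *\<^sub>R h)) * norm h"
      using lipschitz_onD[OF lip, of "x + t *\<^sub>R h" x]
      by (intro mult_right_mono) (auto simp: dist_norm)
    also have "\<dots> = L * t * (norm h)\<^sup>2" using t by (simp add: power2_eq_square)
    finally show "\<exists>d. (\<phi> has_real_derivative d) (at t) \<and> d \<le> 0"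
      using deriv[of t] by (auto simp: inner_diff_left)
  qed simp
  then show ?thesis by (simp add: \<phi>_def h_def)
qed

lemma convex_gradient_lower_bound:
  fixes f :: "'a::euclidean_space \<Rightarrow> real"
  assumes conv: "convex_on UNIV f" and diff: "\<And>z. f differentiable (at z)"
  shows "f x + gradient f x \<bullet> (y - x) \<le> f y"
proof -
  define h where "h = y - x"
  have "convex_on UNIV (\<lambda>t::real. f (x + t *\<^sub>R h))"
  proof (intro convex_onI)
    fix u a b :: real assume u: "0 < u" "u < 1"
    have eq: "x + ((1 - u) *\<^sub>R a + u *\<^sub>R b) *\<^sub>R h
        = (1 - u) *\<^sub>R (x + a *\<^sub>R h) + u *\<^sub>R (x + b *\<^sub>R h)"
      by (simp add: algebra_simps)
    show "f (x + ((1 - u) *\<^sub>R a + u *\<^sub>R b) *\<^sub>R h)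
        \<le> (1 - u) * f (x + a *\<^sub>R h) + u * f (x + b *\<^sub>R h)"
      unfolding eq using convex_onD[OF conv, of u "x + a *\<^sub>R h" "x + b *\<^sub>R h"] u by simp
  qed simp
  from convex_on_imp_above_tangent[OF this, of 0 1]
    GDERIV_along_line[OF diff, of x h 0]
  show ?thesis by (fastforce simp: h_def)
qed

text \<open>Subtracting the tangent plane at \<open>y\<close> makes \<open>y\<close> a global minimizer, and one gradient step
  of length \<open>1/L\<close> from \<open>x\<close> decreases the new function by at least
  \<open>\<parallel>\<nabla>f x - \<nabla>f y\<parallel>\<^sup>2 / (2 * L)\<close>.\<close>

lemma gradient_gap_le_bregman:
  fixes f :: "'a::euclidean_space \<Rightarrow> real"
  assumes conv: "convex_on UNIV f" and smooth: "L_smooth L f" and "L > 0"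
  shows "(norm (gradient f x - gradient f y))\<^sup>2
    \<le> 2 * L * (f x - f y - gradient f y \<bullet> (x - y))"
proof -
  define d where "d = gradient f x - gradient f y"
  define z where "z = x - (1 / L) *\<^sub>R d"
  have "f y + gradient f y \<bullet> (z - y) \<le> f z"
    using convex_gradient_lower_bound[OF conv] smooth unfolding L_smooth_def by blast
  also have "\<dots> \<le> f x + gradient f x \<bullet> (z - x) + L / 2 * (norm (z - x))\<^sup>2"
    by (rule L_smooth_upper_bound[OF smooth])
  finally have "f y + gradient f y \<bullet> (x - y) - (gradient f y \<bullet> d) / L
      \<le> f x - (gradient f x \<bullet> d) / L + (norm d)\<^sup>2 / (2 * L)"
    using \<open>L > 0\<close>
    by (simp add: z_def inner_diff_right inner_add_right power_mult_distrib power2_eq_square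
        field_simps)
  moreover have "(gradient f x \<bullet> d) / L - (gradient f y \<bullet> d) / L = (norm d)\<^sup>2 / L"
    by (simp add: d_def power2_norm_eq_inner inner_diff_left diff_divide_distrib)
  moreover have "(norm d)\<^sup>2 / L = 2 * ((norm d)\<^sup>2 / (2 * L))" by simp
  ultimately have "(norm d)\<^sup>2 / (2 * L) \<le> f x - f y - gradient f y \<bullet> (x - y)" by linarith
  then show ?thesis using \<open>L > 0\<close> by (simp add: d_def field_simps)
qed

lemma gradient_eq_0_at_min:
  fixes f :: "'a::euclidean_space \<Rightarrow> real"
  assumes "f differentiable (at x)" and "\<And>y. f x \<le> f y"
  shows "gradient f x = 0"
proof -
  have "(\<lambda>h. h \<bullet> gradient f x) = (\<lambda>h. 0)"
    using GDERIV_gradient[OF assms(1)] assms(2) unfolding gderiv_def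
    by (intro has_derivative_local_min) auto
  then show ?thesis by (metis inner_eq_zero_iff)
qed

lemma norm_sum_sq_le:
  fixes a :: "'i \<Rightarrow> 'a::real_inner"
  shows "(norm (\<Sum>i\<in>I. a i))\<^sup>2 \<le> real (card I) * (\<Sum>i\<in>I. (norm (a i))\<^sup>2)"
proof -
  have "(norm (\<Sum>i\<in>I. a i))\<^sup>2 \<le> (\<Sum>i\<in>I. norm (a i))\<^sup>2"
    by (intro power_mono norm_sum) auto
  also have "\<dots> \<le> (\<Sum>i\<in>I. (norm (a i))\<^sup>2) * real (card I)"
    by (rule sum_squared_le_sum_of_squares)
  finally show ?thesis by (simp add: mult.commute)
qed

lemma norm_add_sq_le:
  fixes a b :: "'a::real_inner"
  shows "(norm (a + b))\<^sup>2 \<le> 2 * (norm a)\<^sup>2 + 2 * (norm b)\<^sup>2"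
proof -
  have "0 \<le> (norm (a - b))\<^sup>2" by simp
  then show ?thesis
    by (simp add: power2_norm_eq_inner inner_add_left inner_add_right inner_diff_left
        inner_diff_right inner_commute)
qed

lemma norm_diff_scaleR_sq:
  fixes a b :: "'a::real_inner"
  shows "(norm (a - c *\<^sub>R b))\<^sup>2 = (norm a)\<^sup>2 - 2 * c * (a \<bullet> b) + c\<^sup>2 * (norm b)\<^sup>2"
proof -
  have "(norm (a - c *\<^sub>R b))\<^sup>2 = (norm a)\<^sup>2 + (norm (c *\<^sub>R b))\<^sup>2 - 2 * (a \<bullet> (c *\<^sub>R b))"
    using dot_norm_neg[of a "c *\<^sub>R b"] by simp
  then show ?thesis by (simp add: power_mult_distrib)
qed

text \<open>The variance is at most the second moment.\<close>

lemma sum_centered_sq_le: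
  fixes a :: "'i \<Rightarrow> 'a::real_inner"
  assumes "finite I" and "I \<noteq> {}"
  shows "(\<Sum>i\<in>I. (norm (a i - (1 / real (card I)) *\<^sub>R (\<Sum>i\<in>I. a i)))\<^sup>2) \<le> (\<Sum>i\<in>I. (norm (a i))\<^sup>2)"
proof -
  define c where "c = (1 / real (card I)) *\<^sub>R (\<Sum>i\<in>I. a i)"
  have c: "(\<Sum>i\<in>I. a i) = real (card I) *\<^sub>R c" using assms by (simp add: c_def)
  have "(\<Sum>i\<in>I. (norm (a i - c))\<^sup>2) = (\<Sum>i\<in>I. (norm (a i))\<^sup>2 - 2 * (a i \<bullet> c) + c \<bullet> c)"
    by (intro sum.cong refl)
      (simp add: power2_norm_eq_inner inner_diff_left inner_diff_right inner_commute)
  also have "\<dots> = (\<Sum>i\<in>I. (norm (a i))\<^sup>2) - 2 * ((\<Sum>i\<in>I. a i) \<bullet> c) + real (card I) * (c \<bullet> c)"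
    by (simp add: sum.distrib sum_subtractf sum_distrib_left[symmetric] inner_sum_left)
  also have "\<dots> = (\<Sum>i\<in>I. (norm (a i))\<^sup>2) - real (card I) * (c \<bullet> c)"
    by (simp add: c)
  finally show ?thesis by (simp add: c_def)
qed

lemma norm_mean_sq_le:
  fixes a :: "nat \<Rightarrow> 'a::real_inner"
  assumes "n \<ge> 1"
  shows "(norm ((1 / real n) *\<^sub>R (\<Sum>i=1..n. a i)))\<^sup>2 \<le> 1 / real n * (\<Sum>i=1..n. (norm (a i))\<^sup>2)"
proof -
  have "(norm ((1 / real n) *\<^sub>R (\<Sum>i=1..n. a i)))\<^sup>2 = (1 / real n)\<^sup>2 * (norm (\<Sum>i=1..n. a i))\<^sup>2"
    by (simp add: power_mult_distrib power_divide)
  also have "\<dots> \<le> (1 / real n)\<^sup>2 * (real n * (\<Sum>i=1..n. (norm (a i))\<^sup>2))"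
    using norm_sum_sq_le[of a "{1..n}"] by (intro mult_left_mono) auto
  also have "\<dots> = 1 / real n * (\<Sum>i=1..n. (norm (a i))\<^sup>2)"
    using assms by (simp add: power2_eq_square)
  finally show ?thesis .
qed

lemma convex_on_sum_functions:
  fixes f :: "'i \<Rightarrow> 'a::real_vector \<Rightarrow> real"
  assumes "\<And>i. i \<in> I \<Longrightarrow> convex_on UNIV (f i)"
  shows "convex_on UNIV (\<lambda>y. \<Sum>i\<in>I. f i y)"
  using assms
  by (induction I rule: infinite_finite_induct)
    (auto intro: convex_on_add simp: convex_on_const)

section \<open>The finite-sum objective and the LSVRG estimator\<close>

locale finite_sum_problem =
  fixes fc :: "nat \<Rightarrow> nat \<Rightarrow> 'a::euclidean_space \<Rightarrow> real"
    and n m :: nat and L \<mu> :: real and xs :: 'a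
  assumes n: "n \<ge> 1" and m: "m \<ge> 1" and L: "L > 0" and mu: "\<mu> \<ge> 0"
    and qsc: "quasi_strongly_convex \<mu> (global_loss n m fc) xs"
    and conv: "\<And>i j. i \<in> {1..n} \<Longrightarrow> j \<in> {1..m} \<Longrightarrow> convex_on UNIV (fc i j)"
    and smooth: "\<And>i j. i \<in> {1..n} \<Longrightarrow> j \<in> {1..m} \<Longrightarrow> L_smooth L (fc i j)"
begin

abbreviation "f \<equiv> global_loss n m fc"
abbreviation "\<sigma>sq \<equiv> lsvrg_sigma_sq n m fc xs"

lemma global_loss_eq: "f y = 1 / (real n * real m) * (\<Sum>i=1..n. \<Sum>j=1..m. fc i j y)"
  by (simp add: global_loss_def local_loss_def sum_distrib_left)

lemma diff: "i \<in> {1..n} \<Longrightarrow> j \<in> {1..m} \<Longrightarrow> fc i j differentiable (at y)"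
  using smooth unfolding L_smooth_def by blast

lemma GDERIV_local_loss:
  assumes "i \<in> {1..n}"
  shows "GDERIV (local_loss m fc i) y :> (1 / real m) *\<^sub>R (\<Sum>j=1..m. gradient (fc i j) y)"
proof -
  have "local_loss m fc i = (\<lambda>y. (1 / real m) * (\<Sum>j=1..m. fc i j y))"
    by (rule ext) (simp add: local_loss_def)
  moreover have "GDERIV (\<lambda>y. (1 / real m) * (\<Sum>j=1..m. fc i j y)) y
      :> (1 / real m) *\<^sub>R (\<Sum>j=1..m. gradient (fc i j) y)"
    by (intro GDERIV_cmult GDERIV_sum GDERIV_gradient diff[OF assms])
  ultimately show ?thesis by (simp only:)
qed

lemmas gradient_local_loss = gradient_eqI[OF GDERIV_local_loss]

lemma GDERIV_global_loss:
  "GDERIV f y :> (1 / real n) *\<^sub>R (\<Sum>i=1..n. gradient (local_loss m fc i) y)"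
proof -
  have "f = (\<lambda>y. (1 / real n) * (\<Sum>i=1..n. local_loss m fc i y))"
    by (rule ext) (simp add: global_loss_def)
  moreover have "GDERIV (local_loss m fc i) y :> gradient (local_loss m fc i) y"
    if "i \<in> {1..n}" for i
    using GDERIV_local_loss[OF that] gradient_local_loss[OF that] by simp
  then have "GDERIV (\<lambda>y. (1 / real n) * (\<Sum>i=1..n. local_loss m fc i y)) y
      :> (1 / real n) *\<^sub>R (\<Sum>i=1..n. gradient (local_loss m fc i) y)"
    by (intro GDERIV_cmult GDERIV_sum)
  ultimately show ?thesis by (simp only:)
qed

lemmas gradient_global_loss = gradient_eqI[OF GDERIV_global_loss]

lemma gradient_global_loss_sum:
  "gradient f y = (1 / (real n * real m)) *\<^sub>R (\<Sum>i=1..n. \<Sum>j=1..m. gradient (fc i j) y)"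
proof -
  have "(\<Sum>i=1..n. gradient (local_loss m fc i) y)
      = (\<Sum>i=1..n. (1 / real m) *\<^sub>R (\<Sum>j=1..m. gradient (fc i j) y))"
    by (intro sum.cong refl gradient_local_loss)
  then show ?thesis by (simp add: gradient_global_loss scaleR_sum_right)
qed

lemma global_loss_convex: "convex_on UNIV f"
proof -
  have "convex_on UNIV (\<lambda>y. \<Sum>i=1..n. \<Sum>j=1..m. fc i j y)"
    by (intro convex_on_sum_functions conv)
  from convex_on_cmul[OF _ this, of "1 / (real n * real m)"] show ?thesis
    by (simp add: global_loss_eq[abs_def])
qed

lemma global_loss_min: "f xs \<le> f y"
  using qsc unfolding quasi_strongly_convex_def by blast

lemma gradient_global_loss_min: "gradient f xs = 0"
  using global_loss_min GDERIV_global_loss[of xs]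
  by (intro gradient_eq_0_at_min) (auto simp: gderiv_def differentiable_def)

text \<open>The Bregman distances of the components average to that of \<open>f\<close>, whose linear term vanishes
  at the minimizer.\<close>

lemma sigma_sq_const_le: "\<sigma>sq (\<lambda>_. y) \<le> 2 * L * (f y - f xs)"
proof -
  let ?c = "1 / (real n * real m)"
  have "\<sigma>sq (\<lambda>_. y) \<le> ?c * (\<Sum>i=1..n. \<Sum>j=1..m. 2 * L * (fc i j y - fc i j xs - gradient (fc i j) xs \<bullet> (y - xs)))"
    unfolding lsvrg_sigma_sq_def
    using conv smooth L by (intro mult_left_mono sum_mono gradient_gap_le_bregman) auto
  also have "\<dots> = 2 * L * (f y - f xs - gradient f xs \<bullet> (y - xs))"
    by (simp add: global_loss_eq gradient_global_loss_sum sum_distrib_left sum_subtractf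
        inner_sum_left right_diff_distrib)
  finally show ?thesis by (simp add: gradient_global_loss_min)
qed

lemma sigma_sq_nonneg: "0 \<le> \<sigma>sq u"
  unfolding lsvrg_sigma_sq_def by (intro mult_nonneg_nonneg sum_nonneg) auto

text \<open>The gradient at \<open>y\<close> is the mean of the differences \<open>\<nabla>f\<^sub>i\<^sub>j(y) - \<nabla>f\<^sub>i\<^sub>j(x\<^sup>*)\<close>, because the full
  gradient vanishes at the minimizer.\<close>

lemma gradient_sq_le: "(norm (gradient f y))\<^sup>2 \<le> 2 * L * (f y - f xs)"
proof -
  let ?d = "\<lambda>i j. gradient (fc i j) y - gradient (fc i j) xs"
  have "gradient f y = gradient f y - gradient f xs" by (simp add: gradient_global_loss_min)
  also have "\<dots> = (1 / real n) *\<^sub>R (\<Sum>i=1..n. (1 / real m) *\<^sub>R (\<Sum>j=1..m. ?d i j))"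
    by (simp add: gradient_global_loss_sum sum_subtractf scaleR_sum_right scaleR_diff_right)
  also have "(norm \<dots>)\<^sup>2 \<le> 1 / real n * (\<Sum>i=1..n. (norm ((1 / real m) *\<^sub>R (\<Sum>j=1..m. ?d i j)))\<^sup>2)"
    by (rule norm_mean_sq_le[OF n])
  also have "\<dots> \<le> 1 / real n * (\<Sum>i=1..n. 1 / real m * (\<Sum>j=1..m. (norm (?d i j))\<^sup>2))"
    by (intro mult_left_mono sum_mono norm_mean_sq_le[OF m]) auto
  also have "\<dots> = \<sigma>sq (\<lambda>_. y)" by (simp add: lsvrg_sigma_sq_def sum_distrib_left)
  also have "\<dots> \<le> 2 * L * (f y - f xs)" by (rule sigma_sq_const_le)
  finally show ?thesis .
qed

lemma global_loss_upper_bound: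
  "f z \<le> f y + gradient f y \<bullet> (z - y) + L / 2 * (norm (z - y))\<^sup>2"
proof -
  let ?c = "1 / (real n * real m)"
  have "f z \<le> ?c * (\<Sum>i=1..n. \<Sum>j=1..m. fc i j y + gradient (fc i j) y \<bullet> (z - y) + L / 2 * (norm (z - y))\<^sup>2)"
    unfolding global_loss_eq
    by (intro mult_left_mono sum_mono L_smooth_upper_bound smooth) auto
  also have "\<dots> = f y + gradient f y \<bullet> (z - y) + L / 2 * (norm (z - y))\<^sup>2"
    using n m by (simp add: global_loss_eq gradient_global_loss_sum sum.distrib inner_sum_left
        distrib_left sum_distrib_left)
  finally show ?thesis .
qed

lemma quasi_strong_convexity:
  "f y - f xs + \<mu> / 2 * (norm (y - xs))\<^sup>2 \<le> gradient f y \<bullet> (y - xs)"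
proof -
  have "f y + gradient f y \<bullet> (xs - y) + \<mu> / 2 * (norm (y - xs))\<^sup>2 \<le> f xs"
    using qsc unfolding quasi_strongly_convex_def by blast
  then show ?thesis by (simp add: inner_diff_right)
qed

text \<open>At any point other than \<open>xs\<close> the quadratic lower bound lies below the quadratic upper bound
  given by smoothness; such a point exists because a Euclidean space has positive dimension.\<close>

lemma mu_le_L: "\<mu> \<le> L"
proof -
  obtain b :: 'a where b: "b \<in> Basis" using nonempty_Basis by blast
  define y where "y = xs + b"
  have "\<mu> / 2 * (norm (y - xs))\<^sup>2 \<le> L / 2 * (norm (xs - y))\<^sup>2"
    using quasi_strong_convexity[of y] global_loss_upper_bound[of xs y]
    by (simp add: inner_diff_right)
  then show ?thesis using b by (simp add: y_def)
qed

definition estimator :: "nat \<Rightarrow> nat \<Rightarrow> 'a \<Rightarrow> 'a \<Rightarrow> 'a" where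
  "estimator i j y u = gradient (fc i j) y - gradient (fc i j) u + gradient (local_loss m fc i) u"

lemma estimator_mean:
  assumes "i \<in> {1..n}"
  shows "(1 / real m) *\<^sub>R (\<Sum>j=1..m. estimator i j y u) = gradient (local_loss m fc i) y"
proof -
  have "(\<Sum>j=1..m. estimator i j y u) = (\<Sum>j=1..m. gradient (fc i j) y)
      - (\<Sum>j=1..m. gradient (fc i j) u) + real m *\<^sub>R gradient (local_loss m fc i) u"
    by (simp add: estimator_def sum.distrib sum_subtractf sum_constant_scaleR)
  also have "\<dots> = (\<Sum>j=1..m. gradient (fc i j) y)"
    using m by (simp add: gradient_local_loss[OF assms])
  finally show ?thesis by (simp add: gradient_local_loss[OF assms])
qed

text \<open>Centring at \<open>\<nabla>f\<^sub>i(x\<^sup>*)\<close> splits the estimator into a part that measures the distance of \<open>y\<close> from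
  the minimizer and a centred part that depends on the reference point \<open>u\<close> only.\<close>

lemma estimator_second_moment:
  assumes i: "i \<in> {1..n}"
  shows "(\<Sum>j=1..m. (norm (estimator i j y u - gradient (local_loss m fc i) xs))\<^sup>2)
    \<le> 2 * (\<Sum>j=1..m. (norm (gradient (fc i j) y - gradient (fc i j) xs))\<^sup>2)
      + 2 * (\<Sum>j=1..m. (norm (gradient (fc i j) u - gradient (fc i j) xs))\<^sup>2)"
proof -
  let ?a = "\<lambda>j. gradient (fc i j) y - gradient (fc i j) xs"
  let ?b = "\<lambda>j. gradient (fc i j) u - gradient (fc i j) xs"
  let ?c = "(1 / real (card {1..m})) *\<^sub>R (\<Sum>j=1..m. ?b j)"
  have c: "?c = gradient (local_loss m fc i) u - gradient (local_loss m fc i) xs"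
    by (simp add: gradient_local_loss[OF i] sum_subtractf scaleR_diff_right)
  have "(\<Sum>j=1..m. (norm (estimator i j y u - gradient (local_loss m fc i) xs))\<^sup>2)
      \<le> (\<Sum>j=1..m. 2 * (norm (?a j))\<^sup>2 + 2 * (norm (- (?b j - ?c)))\<^sup>2)"
  proof (intro sum_mono)
    fix j
    have *: "estimator i j y u - gradient (local_loss m fc i) xs = ?a j + - (?b j - ?c)"
      unfolding c by (simp add: estimator_def)
    show "(norm (estimator i j y u - gradient (local_loss m fc i) xs))\<^sup>2
        \<le> 2 * (norm (?a j))\<^sup>2 + 2 * (norm (- (?b j - ?c)))\<^sup>2"
      unfolding * by (rule norm_add_sq_le)
  qed
  also have "\<dots> = 2 * (\<Sum>j=1..m. (norm (?a j))\<^sup>2) + 2 * (\<Sum>j=1..m. (norm (?b j - ?c))\<^sup>2)"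
    by (simp only: norm_minus_cancel sum.distrib sum_distrib_left)
  also have "\<dots> \<le> 2 * (\<Sum>j=1..m. (norm (?a j))\<^sup>2) + 2 * (\<Sum>j=1..m. (norm (?b j))\<^sup>2)"
    using m by (intro add_mono mult_left_mono sum_centered_sq_le) auto
  finally show ?thesis .
qed

end

section \<open>Weighted recursions\<close>

lemma weight_pos: "\<eta> < 1 \<Longrightarrow> 0 < weight \<eta> k"
  by (simp add: weight_def)

lemma weight_Suc: "\<eta> < 1 \<Longrightarrow> (1 - \<eta>) * weight \<eta> (Suc k) = weight \<eta> k"
  by (simp add: weight_def)

text \<open>The weights grow by the factor \<open>1/(1 - \<eta>)\<close>, which is slower than the decay \<open>1 - p\<close>: since
  \<open>1 - p \<le> (1 - 3p/4)(1 - p/4)\<close>, the weighted sequence still contracts with factor \<open>1 - 3p/4\<close>, and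
  summing the geometric recursion produces \<open>4/(3p)\<close>.\<close>

lemma weighted_sum_contraction:
  assumes s: "\<And>k. 0 \<le> s k" and r: "\<And>k. 0 \<le> r k" and c: "0 \<le> c"
    and p: "0 < p" "p \<le> 1" and eta: "0 \<le> \<eta>" "\<eta> \<le> p / 4"
    and rec: "\<And>k. s (Suc k) \<le> (1 - p) * s k + c * r k"
  shows "(\<Sum>k=0..K. weight \<eta> k * s k)
    \<le> 4 / (3 * p) * (s 0 / (1 - \<eta>) + c / (1 - \<eta>) * (\<Sum>k=0..K. weight \<eta> k * r k))"
proof -
  define a where "a k = weight \<eta> k * s k" for k
  define b where "b k = c / (1 - \<eta>) * (weight \<eta> k * r k)" for k
  have eta1: "\<eta> < 1" using p eta by linarith
  have a0: "0 \<le> a k" and b0: "0 \<le> b k" for k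
    using s r c weight_pos[OF eta1] eta1 by (auto simp: a_def b_def less_imp_le)
  have step: "a (Suc k) \<le> (1 - 3 * p / 4) * a k + b k" for k
  proof -
    have "(1 - p) \<le> (1 - 3 * p / 4) * (1 - p / 4)"
      by (simp add: algebra_simps)
    also have "\<dots> \<le> (1 - 3 * p / 4) * (1 - \<eta>)"
      using p eta by (intro mult_left_mono) auto
    finally have *: "(1 - p) * a k \<le> (1 - 3 * p / 4) * (1 - \<eta>) * a k"
      by (intro mult_right_mono a0)
    have "(1 - \<eta>) * a (Suc k) = weight \<eta> k * s (Suc k)"
      using weight_Suc[OF eta1] by (simp add: a_def mult.assoc[symmetric])
    also have "\<dots> \<le> weight \<eta> k * ((1 - p) * s k + c * r k)"
      using rec weight_pos[OF eta1] by (intro mult_left_mono) (auto simp: less_imp_le)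
    also have "\<dots> = (1 - p) * a k + (1 - \<eta>) * b k"
    proof -
      have "(1 - \<eta>) * b k = c * (weight \<eta> k * r k)" using eta1 by (simp add: b_def)
      then show ?thesis by (simp add: a_def algebra_simps)
    qed
    also have "\<dots> \<le> (1 - \<eta>) * ((1 - 3 * p / 4) * a k + b k)"
      using * by (simp add: algebra_simps)
    finally show ?thesis using eta1 by simp
  qed
  have "(\<Sum>k=0..Suc K. a k) \<le> a 0 + (1 - 3 * p / 4) * (\<Sum>k=0..K. a k) + (\<Sum>k=0..K. b k)"
  proof (induction K)
    case 0
    then show ?case using step[of 0] by (simp add: algebra_simps add_divide_distrib)
  next
    case (Suc K)
    then show ?case using step[of "Suc K"] by (simp add: algebra_simps add_divide_distrib)
  qed
  moreover have "(\<Sum>k=0..K. a k) \<le> (\<Sum>k=0..Suc K. a k)" using a0 by simp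
  ultimately have "3 * p / 4 * (\<Sum>k=0..K. a k) \<le> a 0 + (\<Sum>k=0..K. b k)"
    by (simp add: algebra_simps)
  then have "(\<Sum>k=0..K. a k) \<le> 4 / (3 * p) * (a 0 + (\<Sum>k=0..K. b k))"
    using p by (simp add: field_simps)
  then show ?thesis
    by (simp add: a_def b_def sum_distrib_left weight_def)
qed

text \<open>Each index belongs to at most \<open>\<tau>\<close> windows.\<close>

lemma sum_window_le:
  fixes b :: "nat \<Rightarrow> real"
  assumes "\<And>k. 0 \<le> b k"
  shows "(\<Sum>k=0..K. \<Sum>t\<in>{k - \<tau>..<k}. b t) \<le> real \<tau> * (\<Sum>k=0..K. b k)"
proof -
  have "(\<Sum>k=0..K. \<Sum>t\<in>{k - \<tau>..<k}. b t)
      = (\<Sum>k\<in>{0..K}. \<Sum>t | t \<in> {0..K} \<and> (k - \<tau> \<le> t \<and> t < k). b t)"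
    by (intro sum.cong refl) auto
  also have "\<dots> = (\<Sum>t\<in>{0..K}. \<Sum>k | k \<in> {0..K} \<and> (k - \<tau> \<le> t \<and> t < k). b t)"
    by (rule sum.swap_restrict) auto
  also have "\<dots> \<le> (\<Sum>t\<in>{0..K}. real \<tau> * b t)"
  proof (intro sum_mono)
    fix t
    have "card {k. k \<in> {0..K} \<and> (k - \<tau> \<le> t \<and> t < k)} \<le> card {t<..t + \<tau>}"
      by (intro card_mono) auto
    then show "(\<Sum>k | k \<in> {0..K} \<and> (k - \<tau> \<le> t \<and> t < k). b t) \<le> real \<tau> * b t"
      using assms by (simp add: mult_right_mono)
  qed
  finally show ?thesis by (simp add: sum_distrib_left)
qed

text \<open>Bernoulli's inequality: \<open>(1 - \<eta>)\<^sup>\<tau> \<ge> 1 - \<eta>\<tau> \<ge> 15/16\<close>.\<close>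

lemma weight_window:
  assumes "0 \<le> \<eta>" "\<eta> < 1" "\<eta> * real \<tau> \<le> 1 / 16" and t: "t \<in> {k - \<tau>..<k}"
  shows "weight \<eta> k \<le> 16 / 15 * weight \<eta> t"
proof -
  have "1 - 1 / 16 \<le> 1 + real (k - t) * (- \<eta>)"
  proof -
    have "\<eta> * real (k - t) \<le> \<eta> * real \<tau>" using t assms(1) by (intro mult_left_mono) auto
    then show ?thesis using assms(3) by (simp add: mult.commute)
  qed
  also have "\<dots> \<le> (1 + - \<eta>) ^ (k - t)"
    by (rule Bernoulli_inequality) (use assms in auto)
  finally have B: "15 / 16 \<le> (1 - \<eta>) ^ (k - t)" by simp
  have "weight \<eta> t = weight \<eta> k * (1 - \<eta>) ^ (k - t)"
  proof -
    have "(1 - \<eta>) ^ (k + 1) = (1 - \<eta>) ^ (t + 1) * (1 - \<eta>) ^ (k - t)"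
      using t by (simp add: power_add[symmetric])
    then show ?thesis using assms(2) by (simp add: weight_def)
  qed
  also have "\<dots> \<ge> weight \<eta> k * (15 / 16)"
    using B weight_pos[OF assms(2)] by (intro mult_left_mono) (auto simp: less_imp_le)
  finally show ?thesis by simp
qed

lemma weighted_sum_window_le:
  assumes a: "\<And>k. 0 \<le> a k" and eta: "0 \<le> \<eta>" "\<eta> < 1" "\<eta> * real \<tau> \<le> 1 / 16"
  shows "(\<Sum>k=0..K. weight \<eta> k * (\<Sum>t\<in>{k - \<tau>..<k}. a t))
    \<le> 16 / 15 * real \<tau> * (\<Sum>k=0..K. weight \<eta> k * a k)"
proof -
  have w: "0 \<le> weight \<eta> k" for k using weight_pos[OF eta(2)] by (simp add: less_imp_le)
  have "(\<Sum>k=0..K. weight \<eta> k * (\<Sum>t\<in>{k - \<tau>..<k}. a t))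
      \<le> (\<Sum>k=0..K. \<Sum>t\<in>{k - \<tau>..<k}. 16 / 15 * (weight \<eta> t * a t))"
    unfolding sum_distrib_left
  proof (intro sum_mono)
    fix k t assume "t \<in> {k - \<tau>..<k}"
    from mult_right_mono[OF weight_window[OF eta this] a]
    show "weight \<eta> k * a t \<le> 16 / 15 * (weight \<eta> t * a t)" by (simp add: mult.assoc)
  qed
  also have "\<dots> = 16 / 15 * (\<Sum>k=0..K. \<Sum>t\<in>{k - \<tau>..<k}. weight \<eta> t * a t)"
    by (simp add: sum_distrib_left)
  also have "\<dots> \<le> 16 / 15 * (real \<tau> * (\<Sum>k=0..K. weight \<eta> k * a k))"
    using w a by (intro mult_left_mono sum_window_le) auto
  finally show ?thesis by (simp add: mult.assoc)
qed

text \<open>Since \<open>(1 - \<eta>) w\<^sub>k\<^sub>+\<^sub>1 = w\<^sub>k\<close>, the weighted recursion telescopes.\<close>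

lemma weighted_descent:
  assumes T: "\<And>k. 0 \<le> T k" and eta: "\<eta> < 1"
    and step: "\<And>k. T (Suc k) \<le> (1 - \<eta>) * T k - d k"
  shows "(\<Sum>k=0..K. weight \<eta> k * d k) \<le> T 0"
proof -
  have w: "0 \<le> weight \<eta> k" for k using weight_pos[OF eta] by (simp add: less_imp_le)
  have *: "weight \<eta> k * T (Suc k) + weight \<eta> k * d k \<le> (1 - \<eta>) * weight \<eta> k * T k" for k
    using mult_left_mono[OF step[of k] w[of k]] by (simp add: algebra_simps)
  have "weight \<eta> K * T (Suc K) + (\<Sum>k=0..K. weight \<eta> k * d k) \<le> T 0"
  proof (induction K)
    case 0
    then show ?case using *[of 0] eta by (simp add: weight_def)
  next
    case (Suc K)
    then show ?case using *[of "Suc K"] weight_Suc[OF eta, of K] by simp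
  qed
  then show ?thesis using mult_nonneg_nonneg[OF w T, of K "Suc K"] by linarith
qed

lemma weight_sum_ge: "0 \<le> \<eta> \<Longrightarrow> \<eta> < 1 \<Longrightarrow> 1 / (1 - \<eta>) ^ K \<le> weight_sum \<eta> K"
proof -
  assume eta: "0 \<le> \<eta>" "\<eta> < 1"
  have "(1 - \<eta>) ^ (K + 1) \<le> (1 - \<eta>) ^ K" using eta by (intro power_decreasing) auto
  then have "1 / (1 - \<eta>) ^ K \<le> weight \<eta> K"
    using eta unfolding weight_def by (intro divide_left_mono) auto
  also have "\<dots> \<le> weight_sum \<eta> K"
    unfolding weight_sum_def using weight_pos[OF eta(2)]
    by (intro member_le_sum) (auto simp: less_imp_le)
  finally show ?thesis .
qed

lemma weight_sum_0: "weight_sum 0 K = real K + 1"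
  by (simp add: weight_sum_def weight_def)

section \<open>Discrete random variables and conditioning on the past\<close>

text \<open>The countable range covers the null set on which a draw may leave its prescribed finite
  support, where the functions applied to it are arbitrary. The measurable structure on the target
  is the discrete one, so that composition with any function is again measurable.\<close>

definition discrete_rv :: "'w measure \<Rightarrow> 'w measure \<Rightarrow> ('w \<Rightarrow> 'b) \<Rightarrow> bool" where
  "discrete_rv M F X \<longleftrightarrow> X \<in> F \<rightarrow>\<^sub>M count_space UNIV \<and> countable (X ` space F) \<and>
     (\<exists>S. finite S \<and> (AE \<omega> in M. X \<omega> \<in> S))"

lemma discrete_rv_const: "discrete_rv M F (\<lambda>\<omega>. c)"
  unfolding discrete_rv_def
  by (auto intro!: exI[of _ "{c}"] countable_subset[of "(\<lambda>\<omega>. c) ` space F" "{c}"])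

text \<open>Measurability for an arbitrary \<open>h\<close> comes from writing a preimage as a countable union over the
  values of \<open>X\<close>.\<close>

lemma discrete_rv_map2:
  assumes X: "discrete_rv M F X" and Y: "discrete_rv M F Y"
  shows "discrete_rv M F (\<lambda>\<omega>. h (X \<omega>) (Y \<omega>))"
proof -
  have X': "X \<in> F \<rightarrow>\<^sub>M count_space UNIV" "countable (X ` space F)"
    and Y': "Y \<in> F \<rightarrow>\<^sub>M count_space UNIV" "countable (Y ` space F)"
    using X Y unfolding discrete_rv_def by auto
  obtain S T where S: "finite S" "AE \<omega> in M. X \<omega> \<in> S" and T: "finite T" "AE \<omega> in M. Y \<omega> \<in> T"
    using X Y unfolding discrete_rv_def by blast
  have X_pre: "X -` {a} \<inter> space F \<in> sets F" for a
    by (rule measurable_sets[OF X'(1)]) simp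
  have Y_pre: "Y -` C \<inter> space F \<in> sets F" for C
    by (rule measurable_sets[OF Y'(1)]) simp
  have "(\<lambda>\<omega>. h (X \<omega>) (Y \<omega>)) \<in> F \<rightarrow>\<^sub>M count_space UNIV"
  proof (rule measurableI)
    fix B
    have "(\<lambda>\<omega>. h (X \<omega>) (Y \<omega>)) -` B \<inter> space F
        = (\<Union>a\<in>X ` space F. (X -` {a} \<inter> space F) \<inter> (Y -` {b. h a b \<in> B} \<inter> space F))"
      by auto
    also have "\<dots> \<in> sets F"
      by (intro sets.countable_UN'' sets.Int X_pre Y_pre X'(2))
    finally show "(\<lambda>\<omega>. h (X \<omega>) (Y \<omega>)) -` B \<inter> space F \<in> sets F" .
  qed simp
  moreover have "countable ((\<lambda>\<omega>. h (X \<omega>) (Y \<omega>)) ` space F)"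
  proof -
    have "(\<lambda>\<omega>. (X \<omega>, Y \<omega>)) ` space F \<subseteq> X ` space F \<times> Y ` space F" by blast
    then have "countable ((\<lambda>\<omega>. (X \<omega>, Y \<omega>)) ` space F)"
      using X'(2) Y'(2) by (rule countable_subset[OF _ countable_SIGMA])
    from countable_image[OF this, of "\<lambda>(a, b). h a b"] show ?thesis by (simp add: image_image)
  qed
  moreover have "\<exists>U. finite U \<and> (AE \<omega> in M. h (X \<omega>) (Y \<omega>) \<in> U)"
  proof (intro exI conjI)
    show "finite ((\<lambda>(a, b). h a b) ` (S \<times> T))" using S(1) T(1) by simp
    show "AE \<omega> in M. h (X \<omega>) (Y \<omega>) \<in> (\<lambda>(a, b). h a b) ` (S \<times> T)"
      using S(2) T(2) by eventually_elim (rule rev_image_eqI[OF SigmaI], auto)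
  qed
  ultimately show ?thesis unfolding discrete_rv_def by (intro conjI)
qed

lemma discrete_rv_map: "discrete_rv M F X \<Longrightarrow> discrete_rv M F (\<lambda>\<omega>. h (X \<omega>))"
  using discrete_rv_map2[of M F X X "\<lambda>a b. h a"] by simp

lemma discrete_rv_map3:
  assumes "discrete_rv M F X" and "discrete_rv M F Y" and "discrete_rv M F Z"
  shows "discrete_rv M F (\<lambda>\<omega>. h (X \<omega>) (Y \<omega>) (Z \<omega>))"
  using discrete_rv_map2[OF discrete_rv_map2[OF assms(1,2), of Pair] assms(3),
      of "\<lambda>(a, b) c. h a b c"] by simp

lemma discrete_rv_sum:
  assumes "\<And>i. i \<in> I \<Longrightarrow> discrete_rv M F (X i)"
  shows "discrete_rv M F (\<lambda>\<omega>. \<Sum>i\<in>I. X i \<omega> :: 'b::comm_monoid_add)"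
  using assms
proof (induction I rule: infinite_finite_induct)
  case (insert i I)
  then have "discrete_rv M F (X i)" and "discrete_rv M F (\<lambda>\<omega>. \<Sum>i\<in>I. X i \<omega>)" by auto
  from discrete_rv_map2[OF this, of "(+)"] show ?case using insert.hyps by simp
qed (simp_all add: discrete_rv_const)

lemma discrete_rv_cong:
  assumes "space F = space M" and "\<And>\<omega>. \<omega> \<in> space M \<Longrightarrow> X \<omega> = Y \<omega>" and "discrete_rv M F Y"
  shows "discrete_rv M F X"
proof -
  have "X ` space F = Y ` space F" using assms(1,2) by (intro image_cong) auto
  moreover have "X \<in> F \<rightarrow>\<^sub>M count_space UNIV \<longleftrightarrow> Y \<in> F \<rightarrow>\<^sub>M count_space UNIV"
    using assms(1,2) by (intro measurable_cong) auto
  moreover have "(AE \<omega> in M. X \<omega> \<in> S) \<longleftrightarrow> (AE \<omega> in M. Y \<omega> \<in> S)" for S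
    using assms(2) by (intro AE_cong) auto
  ultimately show ?thesis using assms(3) unfolding discrete_rv_def by auto
qed

lemma discrete_rv_subalgebra:
  assumes "subalgebra M F" and "discrete_rv M F X"
  shows "discrete_rv M M X"
proof -
  have "X \<in> M \<rightarrow>\<^sub>M count_space UNIV"
    by (rule measurable_from_subalg[OF assms(1)]) (use assms(2) in \<open>simp add: discrete_rv_def\<close>)
  moreover have "countable (X ` space M)"
    using assms unfolding discrete_rv_def subalgebra_def by simp
  ultimately show ?thesis using assms(2) unfolding discrete_rv_def by blast
qed

lemma discrete_rv_measurable:
  "discrete_rv M F X \<Longrightarrow> space N = UNIV \<Longrightarrow> X \<in> F \<rightarrow>\<^sub>M N"
  unfolding discrete_rv_def
  using measurable_compose[of X F "count_space UNIV" "\<lambda>y. y" N] by auto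

lemma discrete_rv_integrable:
  fixes X :: "'w \<Rightarrow> 'b::{banach, second_countable_topology}"
  assumes "finite_measure M" and "subalgebra M F" and X: "discrete_rv M F X"
  shows "integrable M X"
proof -
  interpret finite_measure M by fact
  obtain S where S: "finite S" "AE \<omega> in M. X \<omega> \<in> S"
    using X unfolding discrete_rv_def by blast
  have "AE \<omega> in M. norm (X \<omega>) \<le> (\<Sum>s\<in>S. norm s)"
    using S(2)
  proof eventually_elim
    case (elim \<omega>)
    then show ?case by (intro member_le_sum S(1)) auto
  qed
  moreover have "X \<in> borel_measurable M"
    by (rule measurable_from_subalg[OF assms(2) discrete_rv_measurable[OF X]]) simp
  ultimately show ?thesis by (rule integrable_const_bound)
qed

text \<open>The \<open>\<sigma>\<close>-algebra generated by the draws in \<open>J\<close> appears as the preimage of a product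
  \<open>\<sigma>\<close>-algebra, so that independence of the two restrictions of \<open>Z\<close> to \<open>J\<close> and \<open>{i}\<close> applies directly.\<close>

lemma (in prob_space) prob_inter_past:
  assumes indep: "indep_vars (\<lambda>_. count_space UNIV) Z I" and J: "J \<subseteq> I" and i: "i \<in> I" "i \<notin> J"
    and A: "A \<in> sets (vimage_algebra (space M) (\<lambda>\<omega>. restrict (\<lambda>j. Z j \<omega>) J)
                        (PiM J (\<lambda>_. count_space UNIV)))"
  shows "prob (A \<inter> (Z i -` B \<inter> space M)) = prob A * prob (Z i -` B \<inter> space M)"
proof -
  let ?P = "\<lambda>K. PiM K (\<lambda>_. count_space UNIV) :: ('b \<Rightarrow> 'c) measure"
  let ?R = "\<lambda>K \<omega>. restrict (\<lambda>j. Z j \<omega>) K"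
  have ind: "indep_var (?P J) (?R J) (?P {i}) (?R {i})"
    using indep_var_restrict[OF indep, of J "{i}"] J i by auto
  have "?R J \<in> space M \<rightarrow> space (?P J)" by (auto simp: space_PiM)
  then obtain A' where A': "A' \<in> sets (?P J)" "A = ?R J -` A' \<inter> space M"
    using A by (auto simp: sets_vimage_algebra2)
  \<comment> \<open>the event about the single draw, lifted to functions on \<open>{i}\<close>\<close>
  define B' where "B' = (\<lambda>h. h i) -` B \<inter> space (?P {i})"
  have B': "B' \<in> sets (?P {i})"
    unfolding B'_def by (rule measurable_sets[OF measurable_component_singleton]) auto
  have R: "?R {i} \<omega> \<in> B' \<longleftrightarrow> Z i \<omega> \<in> B" for \<omega>
    by (simp add: B'_def space_PiM)
  have "A \<inter> (Z i -` B \<inter> space M) = (\<lambda>\<omega>. (?R J \<omega>, ?R {i} \<omega>)) -` (A' \<times> B') \<inter> space M"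
    and "Z i -` B \<inter> space M = ?R {i} -` B' \<inter> space M"
    unfolding A'(2) using R by blast+
  then show ?thesis using indep_varD[OF ind A'(1) B'] A'(2) by simp
qed

lemma (in sigma_finite_subalgebra) real_cond_exp_sum_on:
  fixes f :: "'b \<Rightarrow> 'a \<Rightarrow> real"
  assumes "\<And>i. i \<in> I \<Longrightarrow> integrable M (f i)"
  shows "AE \<omega> in M. real_cond_exp M F (\<lambda>\<omega>. \<Sum>i\<in>I. f i \<omega>) \<omega> = (\<Sum>i\<in>I. real_cond_exp M F (f i) \<omega>)"
  using real_cond_exp_sum[of "\<lambda>i. if i \<in> I then f i else (\<lambda>_. 0)" I] assms
  by (simp cong: sum.cong)

text \<open>Freezing lemma: a fresh argument is integrated out while the rest is kept fixed. For finitely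
  many values the integrand is a sum of products of a known function and the indicator of an
  independent event.\<close>

lemma (in prob_space) real_cond_exp_independent_argument:
  fixes \<phi> :: "'b \<Rightarrow> 'a \<Rightarrow> real" and q :: "'b \<Rightarrow> real"
  assumes sub: "subalgebra M F"
    and Y: "Y \<in> M \<rightarrow>\<^sub>M count_space UNIV" and S: "finite S" "AE \<omega> in M. Y \<omega> \<in> S"
    and indep: "\<And>A y. A \<in> sets F \<Longrightarrow> y \<in> S \<Longrightarrow> prob (A \<inter> (Y -` {y} \<inter> space M)) = prob A * q y"
    and \<phi>: "\<And>y. y \<in> S \<Longrightarrow> \<phi> y \<in> borel_measurable F" "\<And>y. y \<in> S \<Longrightarrow> integrable M (\<phi> y)"
    and meas: "(\<lambda>\<omega>. \<phi> (Y \<omega>) \<omega>) \<in> borel_measurable M"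
  shows "AE \<omega> in M. real_cond_exp M F (\<lambda>\<omega>. \<phi> (Y \<omega>) \<omega>) \<omega> = (\<Sum>y\<in>S. q y * \<phi> y \<omega>)"
proof -
  interpret finite_measure_subalgebra M F
    by (intro finite_measure_subalgebra.intro finite_measure_subalgebra_axioms.intro sub)
      unfold_locales
  interpret sigma_finite_subalgebra M F by (rule finite_measure_subalgebra_is_sigma_finite) unfold_locales
  define E where "E y = Y -` {y} \<inter> space M" for y
  have E: "E y \<in> sets M" for y
    unfolding E_def by (rule measurable_sets[OF Y]) simp
  have prod_int: "integrable M (\<lambda>\<omega>. \<phi> y \<omega> * indicator (E y) \<omega>)" if "y \<in> S" for y
    using integrable_real_mult_indicator[OF E \<phi>(2)[OF that]] by simp
  have ind: "AE \<omega> in M. real_cond_exp M F (indicator (E y)) \<omega> = q y" if y: "y \<in> S" for y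
  proof (rule real_cond_exp_charact)
    fix A assume A: "A \<in> sets F"
    then have A': "A \<in> sets M" using sub unfolding subalgebra_def by auto
    have "(\<integral>\<omega>\<in>A. indicator (E y) \<omega> \<partial>M) = prob (A \<inter> E y)"
      using A' E by (simp add: set_lebesgue_integral_def indicator_inter_arith[symmetric])
    also have "\<dots> = (\<integral>\<omega>\<in>A. q y \<partial>M)"
      using indep[OF A y] A' by (simp add: E_def set_lebesgue_integral_def)
    finally show "(\<integral>\<omega>\<in>A. indicator (E y) \<omega> \<partial>M) = (\<integral>\<omega>\<in>A. q y \<partial>M)" .
  next
    show "integrable M (indicator (E y) :: _ \<Rightarrow> real)"
      using integrable_real_mult_indicator[OF E, of "\<lambda>_. 1"] by simp
  qed auto
  have one: "AE \<omega> in M. real_cond_exp M F (\<lambda>\<omega>. \<phi> y \<omega> * indicator (E y) \<omega>) \<omega> = q y * \<phi> y \<omega>"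
    if y: "y \<in> S" for y
  proof -
    have "AE \<omega> in M. real_cond_exp M F (\<lambda>\<omega>. \<phi> y \<omega> * indicator (E y) \<omega>) \<omega>
        = \<phi> y \<omega> * real_cond_exp M F (indicator (E y)) \<omega>"
      using \<phi>(1)[OF y] E prod_int[OF y] by (intro real_cond_exp_mult) auto
    with ind[OF y] show ?thesis by eventually_elim simp
  qed
  have "AE \<omega> in M. \<phi> (Y \<omega>) \<omega> = (\<Sum>y\<in>S. \<phi> y \<omega> * indicator (E y) \<omega>)"
    using S(2) AE_space
  proof eventually_elim
    case (elim \<omega>)
    then have "(\<Sum>y\<in>S. \<phi> y \<omega> * indicator (E y) \<omega>) = (\<Sum>y\<in>{Y \<omega>}. \<phi> y \<omega> * indicator (E y) \<omega>)"
      using S(1) by (intro sum.mono_neutral_right) (auto simp: E_def)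
    then show ?case using elim by (simp add: E_def)
  qed
  then have "AE \<omega> in M. real_cond_exp M F (\<lambda>\<omega>. \<phi> (Y \<omega>) \<omega>) \<omega>
      = real_cond_exp M F (\<lambda>\<omega>. \<Sum>y\<in>S. \<phi> y \<omega> * indicator (E y) \<omega>) \<omega>"
    using meas prod_int by (intro real_cond_exp_cong) auto
  moreover have "AE \<omega> in M. real_cond_exp M F (\<lambda>\<omega>. \<Sum>y\<in>S. \<phi> y \<omega> * indicator (E y) \<omega>) \<omega>
      = (\<Sum>y\<in>S. real_cond_exp M F (\<lambda>\<omega>. \<phi> y \<omega> * indicator (E y) \<omega>) \<omega>)"
    using prod_int by (intro real_cond_exp_sum_on) auto
  moreover have "AE \<omega> in M. \<forall>y\<in>S. real_cond_exp M F (\<lambda>\<omega>. \<phi> y \<omega> * indicator (E y) \<omega>) \<omega>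
      = q y * \<phi> y \<omega>"
    using one S(1) by (intro AE_finite_allI) auto
  ultimately show ?thesis by eventually_elim simp
qed

section \<open>Runs of D-LSVRG\<close>

locale dlsvrg_run = finite_sum_problem fc n m L \<mu> xs + prob_space M
  for fc :: "nat \<Rightarrow> nat \<Rightarrow> 'a::euclidean_space \<Rightarrow> real"
    and n m :: nat and L \<mu> :: real and xs :: 'a and M :: "'w measure" +
  fixes \<tau> :: nat and \<gamma> p :: real and x0 :: 'a and w0 :: "nat \<Rightarrow> 'a"
    and idx :: "nat \<Rightarrow> nat \<Rightarrow> 'w \<Rightarrow> nat" and coin :: "nat \<Rightarrow> nat \<Rightarrow> 'w \<Rightarrow> bool"
    and x :: "nat \<Rightarrow> 'w \<Rightarrow> 'a" and w g v e :: "nat \<Rightarrow> nat \<Rightarrow> 'w \<Rightarrow> 'a"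
  assumes tau: "\<tau> \<ge> 1" and p: "0 < p" "p < 1" and gamma: "0 < \<gamma>"
    and gamma_le: "\<gamma> \<le> min (3 / (56 * L))
               (1 / (8 * L * sqrt (real \<tau> * (2 + real \<tau> + 4 / (1 - p)))))"
    and run: "dlsvrg M n m fc \<tau> \<gamma> p x0 w0 idx coin x w g v e"
begin

abbreviation "H \<equiv> history M n x idx coin"
abbreviation "gm \<equiv> worker_mean n g"
abbreviation "em \<equiv> worker_mean n e"
abbreviation "draw \<equiv> \<lambda>(i, k) \<omega>. (idx i k \<omega>, coin i k \<omega>)"

lemma x_0: "\<omega> \<in> space M \<Longrightarrow> x 0 \<omega> = x0"
  and x_Suc: "\<omega> \<in> space M \<Longrightarrow> x (Suc k) \<omega> = x k \<omega> - worker_mean n v k \<omega>"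
  and v_eq: "\<omega> \<in> space M \<Longrightarrow> i \<in> {1..n} \<Longrightarrow>
    v i k \<omega> = (if k \<ge> \<tau> then \<gamma> *\<^sub>R g i (k - \<tau>) \<omega> else 0)"
  and e_0: "\<omega> \<in> space M \<Longrightarrow> i \<in> {1..n} \<Longrightarrow> e i 0 \<omega> = 0"
  and e_Suc: "\<omega> \<in> space M \<Longrightarrow> i \<in> {1..n} \<Longrightarrow> e i (Suc k) \<omega> = e i k \<omega> + \<gamma> *\<^sub>R g i k \<omega> - v i k \<omega>"
  using run unfolding dlsvrg_def delayed_method_def by blast+

lemma w_0: "\<omega> \<in> space M \<Longrightarrow> i \<in> {1..n} \<Longrightarrow> w i 0 \<omega> = w0 i"
  and g_eq: "\<omega> \<in> space M \<Longrightarrow> i \<in> {1..n} \<Longrightarrow> g i k \<omega> = estimator i (idx i k \<omega>) (x k \<omega>) (w i k \<omega>)"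
  and w_Suc: "\<omega> \<in> space M \<Longrightarrow> i \<in> {1..n} \<Longrightarrow>
    w i (Suc k) \<omega> = (if coin i k \<omega> then x k \<omega> else w i k \<omega>)"
  using run unfolding dlsvrg_def lsvrg_estimator_def estimator_def by blast+

lemma mean_error_Suc:
  assumes "\<omega> \<in> space M"
  shows "em (Suc k) \<omega> = em k \<omega> + \<gamma> *\<^sub>R gm k \<omega> - worker_mean n v k \<omega>"
proof -
  have "(\<Sum>i=1..n. e i (Suc k) \<omega>) = (\<Sum>i=1..n. e i k \<omega> + \<gamma> *\<^sub>R g i k \<omega> - v i k \<omega>)"
    using assms by (intro sum.cong refl e_Suc) auto
  then show ?thesis
    by (simp add: worker_mean_def sum.distrib sum_subtractf scaleR_sum_right[symmetric]
        scaleR_add_right scaleR_diff_right)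
qed

lemma mean_update_eq:
  assumes "\<omega> \<in> space M"
  shows "worker_mean n v k \<omega> = (if k \<ge> \<tau> then \<gamma> *\<^sub>R gm (k - \<tau>) \<omega> else 0)"
proof -
  have "(\<Sum>i=1..n. v i k \<omega>) = (\<Sum>i=1..n. if k \<ge> \<tau> then \<gamma> *\<^sub>R g i (k - \<tau>) \<omega> else 0)"
    using assms by (intro sum.cong refl v_eq) auto
  then show ?thesis by (simp add: worker_mean_def scaleR_sum_right[symmetric])
qed

text \<open>The error consists of the updates that have been computed and not yet been applied. The
  truncated subtraction gives the right window also for \<open>k < \<tau>\<close>.\<close>

lemma mean_error_eq:
  assumes "\<omega> \<in> space M"
  shows "em k \<omega> = \<gamma> *\<^sub>R (\<Sum>t\<in>{k - \<tau>..<k}. gm t \<omega>)"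
proof (induction k)
  case 0
  have "(\<Sum>i=1..n. e i 0 \<omega>) = 0" using assms e_0 by (intro sum.neutral) auto
  then show ?case by (simp add: worker_mean_def)
next
  case (Suc k)
  have "(\<Sum>t\<in>{Suc k - \<tau>..<Suc k}. gm t \<omega>)
      = (\<Sum>t\<in>{k - \<tau>..<k}. gm t \<omega>) + gm k \<omega> - (if k \<ge> \<tau> then gm (k - \<tau>) \<omega> else 0)"
  proof (cases "k \<ge> \<tau>")
    case True
    have "(\<Sum>t\<in>{k - \<tau>..<Suc k}. gm t \<omega>) = gm (k - \<tau>) \<omega> + (\<Sum>t\<in>{Suc k - \<tau>..<Suc k}. gm t \<omega>)"
      using True tau by (subst sum.atLeast_Suc_lessThan) (auto simp: Suc_diff_le)
    moreover have "(\<Sum>t\<in>{k - \<tau>..<Suc k}. gm t \<omega>) = (\<Sum>t\<in>{k - \<tau>..<k}. gm t \<omega>) + gm k \<omega>"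
      by (rule sum.atLeastLessThan_Suc) simp
    ultimately have e: "gm (k - \<tau>) \<omega> + (\<Sum>t\<in>{Suc k - \<tau>..<Suc k}. gm t \<omega>)
        = (\<Sum>t\<in>{k - \<tau>..<k}. gm t \<omega>) + gm k \<omega>" by (simp only:)
    show ?thesis using True by (simp add: e[symmetric] del: sum.op_ivl_Suc)
  next
    case False
    then show ?thesis by simp
  qed
  then show ?case
    using mean_error_Suc[OF assms, of k] mean_update_eq[OF assms, of k] Suc.IH
    by (simp add: scaleR_add_right scaleR_diff_right)
qed

definition virtual :: "nat \<Rightarrow> 'w \<Rightarrow> 'a" where "virtual k \<omega> = x k \<omega> - em k \<omega>"

lemma virtual_Suc: "\<omega> \<in> space M \<Longrightarrow> virtual (Suc k) \<omega> = virtual k \<omega> - \<gamma> *\<^sub>R gm k \<omega>"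
  by (simp add: virtual_def x_Suc mean_error_Suc)

lemma draws_indep: "indep_vars (\<lambda>_. count_space UNIV) draw ({1..n} \<times> UNIV)"
  using run unfolding dlsvrg_def fresh_randomness_def by blast

lemma draw_measurable: "i \<in> {1..n} \<Longrightarrow> draw (i, k) \<in> M \<rightarrow>\<^sub>M count_space UNIV"
  using draws_indep unfolding indep_vars_def by auto

lemma prob_draw:
  assumes "i \<in> {1..n}"
  shows "prob (draw (i, k) -` B \<inter> space M)
    = measure_pmf.prob (pair_pmf (pmf_of_set {1..m}) (bernoulli_pmf p)) B"
proof -
  have "distr M (count_space UNIV) (draw (i, k))
      = measure_pmf (pair_pmf (pmf_of_set {1..m}) (bernoulli_pmf p))"
    using run assms unfolding dlsvrg_def fresh_randomness_def by simp
  then show ?thesis using measure_distr[OF draw_measurable[OF assms], of B k] by simp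
qed

lemma idx_measurable: "i \<in> {1..n} \<Longrightarrow> idx i k \<in> M \<rightarrow>\<^sub>M count_space UNIV"
  and coin_measurable: "i \<in> {1..n} \<Longrightarrow> coin i k \<in> M \<rightarrow>\<^sub>M count_space UNIV"
  using measurable_compose[OF draw_measurable[of i k], of fst "count_space UNIV"]
    measurable_compose[OF draw_measurable[of i k], of snd "count_space UNIV"] by auto

lemma prob_idx:
  assumes "i \<in> {1..n}"
  shows "prob (idx i k -` J \<inter> space M) = measure_pmf.prob (pmf_of_set {1..m}) J"
proof -
  have "prob (idx i k -` J \<inter> space M) = prob (draw (i, k) -` (fst -` J) \<inter> space M)"
    by (simp add: vimage_def)
  also have "\<dots> = measure_pmf.prob (map_pmf fst (pair_pmf (pmf_of_set {1..m}) (bernoulli_pmf p))) J"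
    by (simp only: prob_draw[OF assms] measure_map_pmf)
  finally show ?thesis by (simp only: map_fst_pair_pmf)
qed

lemma prob_coin:
  assumes "i \<in> {1..n}"
  shows "prob (coin i k -` C \<inter> space M) = measure_pmf.prob (bernoulli_pmf p) C"
proof -
  have "prob (coin i k -` C \<inter> space M) = prob (draw (i, k) -` (snd -` C) \<inter> space M)"
    by (simp add: vimage_def)
  also have "\<dots> = measure_pmf.prob (map_pmf snd (pair_pmf (pmf_of_set {1..m}) (bernoulli_pmf p))) C"
    by (simp only: prob_draw[OF assms] measure_map_pmf)
  finally show ?thesis by (simp only: map_snd_pair_pmf)
qed

lemma AE_idx:
  assumes "i \<in> {1..n}"
  shows "AE \<omega> in M. idx i k \<omega> \<in> {1..m}"
proof -
  have "prob (idx i k -` {1..m} \<inter> space M) = 1"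
    using m unfolding prob_idx[OF assms] by (subst measure_pmf_of_set) auto
  then have "AE \<omega> in M. \<omega> \<in> idx i k -` {1..m} \<inter> space M"
    using measurable_sets[OF idx_measurable[OF assms], of "{1..m}" k]
    by (subst (asm) prob_eq_1) auto
  then show ?thesis by eventually_elim auto
qed

text \<open>Stated for an arbitrary \<open>\<sigma>\<close>-algebra \<open>F\<close> that knows the first \<open>k\<close> draws, because it is needed for the
  whole probability space, for the history, and for the \<open>\<sigma>\<close>-algebra generated by these draws alone.
  In the last case it yields that \<open>x k\<close> adds nothing to the history beyond the draws.\<close>

lemma trajectory_discrete:
  assumes sp: "space F = space M"
    and draws: "\<And>i t. i \<in> {1..n} \<Longrightarrow> t < k \<Longrightarrow> idx i t \<in> F \<rightarrow>\<^sub>M count_space UNIV"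
      "\<And>i t. i \<in> {1..n} \<Longrightarrow> t < k \<Longrightarrow> coin i t \<in> F \<rightarrow>\<^sub>M count_space UNIV"
  shows "l < k \<Longrightarrow> i \<in> {1..n} \<Longrightarrow> discrete_rv M F (idx i l)"
    and "l < k \<Longrightarrow> i \<in> {1..n} \<Longrightarrow> discrete_rv M F (coin i l)"
    and "l \<le> k \<Longrightarrow> discrete_rv M F (x l)"
    and "l \<le> k \<Longrightarrow> i \<in> {1..n} \<Longrightarrow> discrete_rv M F (w i l)"
    and "l < k \<Longrightarrow> i \<in> {1..n} \<Longrightarrow> discrete_rv M F (g i l)"
    and "l < k \<Longrightarrow> discrete_rv M F (gm l)"
proof -
  have idx: "discrete_rv M F (idx i l)" if "l < k" "i \<in> {1..n}" for i l
    unfolding discrete_rv_def using draws(1)[OF that(2,1)] AE_idx[OF that(2)]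
    by (auto intro!: exI[of _ "{1..m}"])
  have coin: "discrete_rv M F (coin i l)" if "l < k" "i \<in> {1..n}" for i l
    unfolding discrete_rv_def using draws(2)[OF that(2,1)]
    by (auto intro!: exI[of _ UNIV])
  have g: "discrete_rv M F (g i l)"
    if "l < k" "i \<in> {1..n}" "discrete_rv M F (x l)" "discrete_rv M F (w i l)" for i l
    by (rule discrete_rv_cong[OF sp g_eq[OF _ that(2)]
          discrete_rv_map3[OF idx[OF that(1,2)] that(3,4), of "estimator i"]])
  have gm: "discrete_rv M F (gm l)" if "\<And>i. i \<in> {1..n} \<Longrightarrow> discrete_rv M F (g i l)" for l
    unfolding worker_mean_def[abs_def]
    by (rule discrete_rv_map[where h = "\<lambda>s. (1 / real n) *\<^sub>R s"], rule discrete_rv_sum) (rule that)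
  have main: "l \<le> k \<Longrightarrow> discrete_rv M F (x l) \<and> (\<forall>i\<in>{1..n}. discrete_rv M F (w i l))" for l
  proof (induction l rule: less_induct)
    case (less l)
    show ?case
    proof (cases l)
      case 0
      have "discrete_rv M F (x 0)"
        by (rule discrete_rv_cong[OF sp x_0 discrete_rv_const])
      moreover have "discrete_rv M F (w i 0)" if "i \<in> {1..n}" for i
        by (rule discrete_rv_cong[OF sp w_0[OF _ that] discrete_rv_const])
      ultimately show ?thesis using 0 by simp
    next
      case (Suc j)
      then have j: "j < l" "j < k" using less.prems by auto
      have xj: "discrete_rv M F (x j)" and wj: "\<And>i. i \<in> {1..n} \<Longrightarrow> discrete_rv M F (w i j)"
        using less.IH[OF j(1)] j(2) by auto
      have "discrete_rv M F (gm (j - \<tau>))"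
        using less.IH[of "j - \<tau>"] j by (intro gm g) auto
      from discrete_rv_map2[OF xj this, of "\<lambda>a b. a - (if \<tau> \<le> j then \<gamma> *\<^sub>R b else 0)"]
      have "discrete_rv M F (x (Suc j))"
        by (rule discrete_rv_cong[OF sp, rotated]) (simp add: x_Suc mean_update_eq)
      moreover have "discrete_rv M F (w i (Suc j))" if i: "i \<in> {1..n}" for i
        by (rule discrete_rv_cong[OF sp w_Suc[OF _ i]
              discrete_rv_map3[OF coin[OF j(2) i] xj wj[OF i], of "\<lambda>c a b. if c then a else b"]])
      ultimately show ?thesis using Suc by simp
    qed
  qed
  show "l < k \<Longrightarrow> i \<in> {1..n} \<Longrightarrow> discrete_rv M F (idx i l)"
    and "l < k \<Longrightarrow> i \<in> {1..n} \<Longrightarrow> discrete_rv M F (coin i l)" by (fact idx coin)+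
  show "l \<le> k \<Longrightarrow> discrete_rv M F (x l)"
    and "l \<le> k \<Longrightarrow> i \<in> {1..n} \<Longrightarrow> discrete_rv M F (w i l)" using main by auto
  show "l < k \<Longrightarrow> i \<in> {1..n} \<Longrightarrow> discrete_rv M F (g i l)"
    using g main by auto
  show "l < k \<Longrightarrow> discrete_rv M F (gm l)"
    using gm g main by auto
qed

lemma space_H [simp]: "space (H k) = space M"
  by (simp add: history_def space_measure_of_conv)

lemma sets_H: "sets (H k) = sigma_sets (space M)
     ({x k -` B \<inter> space M | B. B \<in> sets borel} \<union>
      {idx i t -` J \<inter> space M | i t J. i \<in> {1..n} \<and> t < k} \<union>
      {coin i t -` C \<inter> space M | i t C. i \<in> {1..n} \<and> t < k})"
  unfolding history_def by (rule sets_measure_of) auto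

lemma sets_H_subset:
  assumes sp: "space F = space M"
    and draws: "\<And>i t. i \<in> {1..n} \<Longrightarrow> t < k \<Longrightarrow> idx i t \<in> F \<rightarrow>\<^sub>M count_space UNIV"
      "\<And>i t. i \<in> {1..n} \<Longrightarrow> t < k \<Longrightarrow> coin i t \<in> F \<rightarrow>\<^sub>M count_space UNIV"
  shows "sets (H k) \<subseteq> sets F"
proof -
  have "x k \<in> borel_measurable F"
    using trajectory_discrete(3)[OF sp draws, of k] by (intro discrete_rv_measurable) auto
  then have "x k -` B \<inter> space M \<in> sets F" if "B \<in> sets borel" for B
    using measurable_sets[of "x k" F borel B] that sp by simp
  moreover have "idx i t -` J \<inter> space M \<in> sets F" if "i \<in> {1..n}" "t < k" for i t J
    using measurable_sets[OF draws(1)[OF that], of J] sp by simp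
  moreover have "coin i t -` C \<inter> space M \<in> sets F" if "i \<in> {1..n}" "t < k" for i t C
    using measurable_sets[OF draws(2)[OF that], of C] sp by simp
  ultimately show ?thesis
    unfolding sets_H sp[symmetric] by (intro sets.sigma_sets_subset) auto
qed

lemma subalgebra_H: "subalgebra M (H k)"
  unfolding subalgebra_def using sets_H_subset[of M k] idx_measurable coin_measurable by simp

lemma draws_measurable_H:
  assumes "i \<in> {1..n}" and "t < k"
  shows "idx i t \<in> H k \<rightarrow>\<^sub>M count_space UNIV" and "coin i t \<in> H k \<rightarrow>\<^sub>M count_space UNIV"
proof -
  have "idx i t -` J \<inter> space M \<in> sets (H k)" for J
    unfolding sets_H by (rule sigma_sets.Basic, rule UnI1, rule UnI2) (use assms in blast)
  moreover have "coin i t -` C \<inter> space M \<in> sets (H k)" for C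
    unfolding sets_H by (rule sigma_sets.Basic, rule UnI2) (use assms in blast)
  ultimately show "idx i t \<in> H k \<rightarrow>\<^sub>M count_space UNIV" and "coin i t \<in> H k \<rightarrow>\<^sub>M count_space UNIV"
    by (auto simp: measurable_def)
qed

lemmas trajectory_H = trajectory_discrete[OF space_H draws_measurable_H]

lemma trajectory_M:
  shows "i \<in> {1..n} \<Longrightarrow> discrete_rv M M (idx i l)"
    and "i \<in> {1..n} \<Longrightarrow> discrete_rv M M (coin i l)"
    and "discrete_rv M M (x l)"
    and "i \<in> {1..n} \<Longrightarrow> discrete_rv M M (w i l)"
    and "i \<in> {1..n} \<Longrightarrow> discrete_rv M M (g i l)"
    and "discrete_rv M M (gm l)"
  using trajectory_discrete[of M "Suc l" l] idx_measurable coin_measurable by auto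

lemma subalgebra_M: "subalgebra M M" by (simp add: subalgebra_def)

lemmas integrable_M = discrete_rv_integrable[OF finite_measure_axioms subalgebra_M]
lemmas integrable_H = discrete_rv_integrable[OF finite_measure_axioms subalgebra_H]

lemma prob_inter_draw:
  assumes i: "i \<in> {1..n}" and A: "A \<in> sets (H k)"
  shows "prob (A \<inter> (draw (i, k) -` B \<inter> space M)) = prob A * prob (draw (i, k) -` B \<inter> space M)"
proof -
  define J where "J = {1..n} \<times> {..<k}"
  define G where "G = vimage_algebra (space M) (\<lambda>\<omega>. restrict (\<lambda>j. draw j \<omega>) J)
    (PiM J (\<lambda>_. count_space UNIV))"
  have sp: "space G = space M" by (simp add: G_def)
  have comp: "draw (i', t) \<in> G \<rightarrow>\<^sub>M count_space UNIV" if "i' \<in> {1..n}" "t < k" for i' t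
  proof -
    have mem: "(i', t) \<in> J" using that by (simp add: J_def)
    have "(\<lambda>\<omega>. restrict (\<lambda>j. draw j \<omega>) J) \<in> G \<rightarrow>\<^sub>M PiM J (\<lambda>_. count_space UNIV)"
      unfolding G_def by (rule measurable_vimage_algebra1) (auto simp: space_PiM)
    from measurable_compose[OF this measurable_component_singleton[OF mem]]
    show ?thesis using mem by simp
  qed
  have "idx i' t \<in> G \<rightarrow>\<^sub>M count_space UNIV" "coin i' t \<in> G \<rightarrow>\<^sub>M count_space UNIV"
    if "i' \<in> {1..n}" "t < k" for i' t
    using measurable_compose[OF comp[OF that], of fst "count_space UNIV"]
      measurable_compose[OF comp[OF that], of snd "count_space UNIV"] by auto
  then have "A \<in> sets G" using sets_H_subset[OF sp] A by blast
  then show ?thesis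
    unfolding G_def using i by (intro prob_inter_past[OF draws_indep]) (auto simp: J_def)
qed

lemma prob_inter_idx:
  assumes "i \<in> {1..n}" and "A \<in> sets (H k)" and "j \<in> {1..m}"
  shows "prob (A \<inter> (idx i k -` {j} \<inter> space M)) = prob A * (1 / real m)"
proof -
  have eq: "idx i k -` {j} \<inter> space M = draw (i, k) -` (fst -` {j}) \<inter> space M"
    by (simp add: vimage_def)
  have "prob (idx i k -` {j} \<inter> space M) = 1 / real m"
    using m assms(3) unfolding prob_idx[OF assms(1)] by (subst measure_pmf_of_set) auto
  then show ?thesis using prob_inter_draw[OF assms(1,2), of "fst -` {j}"] unfolding eq by simp
qed

lemma prob_inter_coin:
  assumes "i \<in> {1..n}" and "A \<in> sets (H k)"
  shows "prob (A \<inter> (coin i k -` {b} \<inter> space M)) = prob A * (if b then p else 1 - p)"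
proof -
  have eq: "coin i k -` {b} \<inter> space M = draw (i, k) -` (snd -` {b}) \<inter> space M"
    by (simp add: vimage_def)
  have "prob (coin i k -` {b} \<inter> space M) = (if b then p else 1 - p)"
    using p unfolding prob_coin[OF assms(1)] by (auto simp: measure_pmf_single)
  then show ?thesis using prob_inter_draw[OF assms(1,2), of "snd -` {b}"] unfolding eq by simp
qed

sublocale H: sigma_finite_subalgebra M "H k" for k
proof -
  interpret finite_measure_subalgebra M "H k"
    by unfold_locales (rule subalgebra_H)
  show "sigma_finite_subalgebra M (H k)"
    by (rule finite_measure_subalgebra_is_sigma_finite) unfold_locales
qed

text \<open>A linear \<open>\<psi>\<close> gives unbiasedness, a quadratic one the second moment bound.\<close>

lemma cond_exp_idx:
  fixes \<psi> :: "nat \<Rightarrow> nat \<Rightarrow> 'a \<Rightarrow> 'a \<Rightarrow> real"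
  shows "AE \<omega> in M. real_cond_exp M (H k) (\<lambda>\<omega>. \<Sum>i=1..n. \<psi> i (idx i k \<omega>) (x k \<omega>) (w i k \<omega>)) \<omega>
    = (\<Sum>i=1..n. 1 / real m * (\<Sum>j=1..m. \<psi> i j (x k \<omega>) (w i k \<omega>)))"
proof -
  have disc: "discrete_rv M M (\<lambda>\<omega>. \<psi> i (idx i k \<omega>) (x k \<omega>) (w i k \<omega>))" if "i \<in> {1..n}" for i
    by (rule discrete_rv_map3[OF trajectory_M(1)[OF that] trajectory_M(3) trajectory_M(4)[OF that]])
  have one: "AE \<omega> in M. real_cond_exp M (H k) (\<lambda>\<omega>. \<psi> i (idx i k \<omega>) (x k \<omega>) (w i k \<omega>)) \<omega>
      = (\<Sum>j=1..m. 1 / real m * \<psi> i j (x k \<omega>) (w i k \<omega>))" if i: "i \<in> {1..n}" for i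
  proof (rule real_cond_exp_independent_argument[where \<phi> = "\<lambda>j \<omega>. \<psi> i j (x k \<omega>) (w i k \<omega>)"])
    have D: "discrete_rv M (H k) (\<lambda>\<omega>. \<psi> i j (x k \<omega>) (w i k \<omega>))" for j
      by (rule discrete_rv_map2[OF trajectory_H(3) trajectory_H(4)]) (use i in auto)
    show "(\<lambda>\<omega>. \<psi> i j (x k \<omega>) (w i k \<omega>)) \<in> borel_measurable (H k)" for j
      by (rule discrete_rv_measurable[OF D]) simp
    show "integrable M (\<lambda>\<omega>. \<psi> i j (x k \<omega>) (w i k \<omega>))" for j
      by (rule integrable_H[OF D])
    show "(\<lambda>\<omega>. \<psi> i (idx i k \<omega>) (x k \<omega>) (w i k \<omega>)) \<in> borel_measurable M"
      by (rule discrete_rv_measurable[OF disc[OF i]]) simp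
  qed (use i AE_idx idx_measurable subalgebra_H prob_inter_idx in auto)
  have "AE \<omega> in M. real_cond_exp M (H k) (\<lambda>\<omega>. \<Sum>i=1..n. \<psi> i (idx i k \<omega>) (x k \<omega>) (w i k \<omega>)) \<omega>
    = (\<Sum>i=1..n. real_cond_exp M (H k) (\<lambda>\<omega>. \<psi> i (idx i k \<omega>) (x k \<omega>) (w i k \<omega>)) \<omega>)"
    by (intro H.real_cond_exp_sum_on integrable_M disc)
  moreover have "AE \<omega> in M. \<forall>i\<in>{1..n}. real_cond_exp M (H k) (\<lambda>\<omega>. \<psi> i (idx i k \<omega>) (x k \<omega>) (w i k \<omega>)) \<omega>
      = (\<Sum>j=1..m. 1 / real m * \<psi> i j (x k \<omega>) (w i k \<omega>))"
    using one by (intro AE_finite_allI) auto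
  ultimately show ?thesis by eventually_elim (simp add: sum_distrib_left)
qed

lemma cond_exp_coin:
  fixes \<psi> :: "nat \<Rightarrow> 'a \<Rightarrow> real"
  shows "AE \<omega> in M. real_cond_exp M (H k) (\<lambda>\<omega>. \<Sum>i=1..n. \<psi> i (w i (Suc k) \<omega>)) \<omega>
    = (\<Sum>i=1..n. p * \<psi> i (x k \<omega>) + (1 - p) * \<psi> i (w i k \<omega>))"
proof -
  define \<phi> where "\<phi> i b \<omega> = \<psi> i (if b then x k \<omega> else w i k \<omega>)" for i b \<omega>
  have disc: "discrete_rv M M (\<lambda>\<omega>. \<phi> i (coin i k \<omega>) \<omega>)" if "i \<in> {1..n}" for i
    unfolding \<phi>_def
    by (rule discrete_rv_map3[OF trajectory_M(2)[OF that] trajectory_M(3) trajectory_M(4)[OF that],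
        where h = "\<lambda>c a b. \<psi> i (if c then a else b)"])
  have one: "AE \<omega> in M. real_cond_exp M (H k) (\<lambda>\<omega>. \<phi> i (coin i k \<omega>) \<omega>) \<omega>
      = (\<Sum>b\<in>UNIV. (if b then p else 1 - p) * \<phi> i b \<omega>)" if i: "i \<in> {1..n}" for i
  proof (rule real_cond_exp_independent_argument)
    have D: "discrete_rv M (H k) (\<phi> i b)" for b
      unfolding \<phi>_def[abs_def]
      by (rule discrete_rv_map2[OF trajectory_H(3) trajectory_H(4), where h = "\<lambda>a c. \<psi> i (if b then a else c)"])
        (use i in auto)
    show "\<phi> i b \<in> borel_measurable (H k)" for b
      by (rule discrete_rv_measurable[OF D]) simp
    show "integrable M (\<phi> i b)" for b by (rule integrable_H[OF D])
    show "(\<lambda>\<omega>. \<phi> i (coin i k \<omega>) \<omega>) \<in> borel_measurable M"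
      by (rule discrete_rv_measurable[OF disc[OF i]]) simp
  qed (use i coin_measurable subalgebra_H prob_inter_coin in auto)
  have "AE \<omega> in M. real_cond_exp M (H k) (\<lambda>\<omega>. \<Sum>i=1..n. \<psi> i (w i (Suc k) \<omega>)) \<omega>
    = real_cond_exp M (H k) (\<lambda>\<omega>. \<Sum>i=1..n. \<phi> i (coin i k \<omega>) \<omega>) \<omega>"
  proof (rule H.real_cond_exp_cong)
    show "AE \<omega> in M. (\<Sum>i=1..n. \<psi> i (w i (Suc k) \<omega>)) = (\<Sum>i=1..n. \<phi> i (coin i k \<omega>) \<omega>)"
      by (rule AE_I2) (auto simp: w_Suc \<phi>_def intro!: sum.cong)
    show "(\<lambda>\<omega>. \<Sum>i=1..n. \<psi> i (w i (Suc k) \<omega>)) \<in> borel_measurable M"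
      by (rule discrete_rv_measurable[OF discrete_rv_sum[OF discrete_rv_map[OF trajectory_M(4)]]]) auto
    show "(\<lambda>\<omega>. \<Sum>i=1..n. \<phi> i (coin i k \<omega>) \<omega>) \<in> borel_measurable M"
      by (rule discrete_rv_measurable[OF discrete_rv_sum[OF disc]]) auto
  qed
  moreover have "AE \<omega> in M. real_cond_exp M (H k) (\<lambda>\<omega>. \<Sum>i=1..n. \<phi> i (coin i k \<omega>) \<omega>) \<omega>
    = (\<Sum>i=1..n. real_cond_exp M (H k) (\<lambda>\<omega>. \<phi> i (coin i k \<omega>) \<omega>) \<omega>)"
    by (intro H.real_cond_exp_sum_on integrable_M disc)
  moreover have "AE \<omega> in M. \<forall>i\<in>{1..n}. real_cond_exp M (H k) (\<lambda>\<omega>. \<phi> i (coin i k \<omega>) \<omega>) \<omega>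
      = (\<Sum>b\<in>UNIV. (if b then p else 1 - p) * \<phi> i b \<omega>)"
    using one by (intro AE_finite_allI) auto
  ultimately show ?thesis by eventually_elim (simp add: UNIV_bool \<phi>_def add.commute)
qed

section \<open>Conditional moments\<close>

lemma cond_exp_gm:
  "AE \<omega> in M. real_cond_exp M (H k) (\<lambda>\<omega>. gm k \<omega> \<bullet> b) \<omega> = gradient f (x k \<omega>) \<bullet> b"
proof -
  define \<psi> where "\<psi> i j u u' = 1 / real n * (estimator i j u u' \<bullet> b)" for i j u u'
  have 1: "AE \<omega> in M. real_cond_exp M (H k) (\<lambda>\<omega>. gm k \<omega> \<bullet> b) \<omega>
      = real_cond_exp M (H k) (\<lambda>\<omega>. \<Sum>i=1..n. \<psi> i (idx i k \<omega>) (x k \<omega>) (w i k \<omega>)) \<omega>"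
  proof (rule H.real_cond_exp_cong)
    have eq: "gm k \<omega> \<bullet> b = (\<Sum>i=1..n. \<psi> i (idx i k \<omega>) (x k \<omega>) (w i k \<omega>))" if "\<omega> \<in> space M" for \<omega>
      using that by (simp add: worker_mean_def \<psi>_def inner_sum_left sum_distrib_left g_eq sum_divide_distrib)
    then show "AE \<omega> in M. gm k \<omega> \<bullet> b = (\<Sum>i=1..n. \<psi> i (idx i k \<omega>) (x k \<omega>) (w i k \<omega>))"
      by (rule AE_I2)
    have D: "discrete_rv M M (\<lambda>\<omega>. gm k \<omega> \<bullet> b)"
      by (rule discrete_rv_map[OF trajectory_M(6)])
    show "(\<lambda>\<omega>. gm k \<omega> \<bullet> b) \<in> borel_measurable M"
      by (rule discrete_rv_measurable[OF D]) simp
    have "discrete_rv M M (\<lambda>\<omega>. \<Sum>i=1..n. \<psi> i (idx i k \<omega>) (x k \<omega>) (w i k \<omega>))"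
      by (rule discrete_rv_cong[OF refl eq[symmetric] D])
    then show "(\<lambda>\<omega>. \<Sum>i=1..n. \<psi> i (idx i k \<omega>) (x k \<omega>) (w i k \<omega>)) \<in> borel_measurable M"
      by (rule discrete_rv_measurable) simp
  qed
  have 2: "(\<Sum>i=1..n. 1 / real m * (\<Sum>j=1..m. \<psi> i j u (u' i))) = gradient f u \<bullet> b" for u u'
  proof -
    have "(\<Sum>i=1..n. 1 / real m * (\<Sum>j=1..m. \<psi> i j u (u' i)))
        = (\<Sum>i=1..n. 1 / real n * (((1 / real m) *\<^sub>R (\<Sum>j=1..m. estimator i j u (u' i))) \<bullet> b))"
      by (simp add: \<psi>_def sum_distrib_left inner_sum_left sum_divide_distrib mult.commute)
    also have "\<dots> = (\<Sum>i=1..n. 1 / real n * (gradient (local_loss m fc i) u \<bullet> b))"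
      by (intro sum.cong refl) (simp only: estimator_mean)
    also have "\<dots> = gradient f u \<bullet> b"
      by (simp add: gradient_global_loss inner_sum_left sum_divide_distrib)
    finally show ?thesis .
  qed
  from 1 cond_exp_idx[of k \<psi>] show ?thesis
  proof eventually_elim
    case (elim \<omega>)
    show ?case unfolding elim by (rule 2)
  qed
qed

lemma vec_cond_exp_gm:
  "AE \<omega> in M. vec_cond_exp M (H k) (gm k) \<omega> = gradient f (x k \<omega>)"
proof -
  have "AE \<omega> in M. \<forall>b\<in>Basis. real_cond_exp M (H k) (\<lambda>\<omega>. gm k \<omega> \<bullet> b) \<omega> = gradient f (x k \<omega>) \<bullet> b"
    by (intro AE_finite_allI cond_exp_gm) simp
  then show ?thesis
    by eventually_elim (simp add: vec_cond_exp_def euclidean_representation)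
qed

lemma norm_gm_sq_le:
  assumes "\<omega> \<in> space M"
  shows "(norm (gm k \<omega>))\<^sup>2 \<le> (\<Sum>i=1..n. 1 / real n *
    (norm (estimator i (idx i k \<omega>) (x k \<omega>) (w i k \<omega>) - gradient (local_loss m fc i) xs))\<^sup>2)"
proof -
  let ?d = "\<lambda>i. estimator i (idx i k \<omega>) (x k \<omega>) (w i k \<omega>) - gradient (local_loss m fc i) xs"
  have "gm k \<omega> = gm k \<omega> - gradient f xs" by (simp add: gradient_global_loss_min)
  also have "\<dots> = (1 / real n) *\<^sub>R (\<Sum>i=1..n. ?d i)"
    using assms
    by (simp add: worker_mean_def gradient_global_loss g_eq sum_subtractf scaleR_diff_right)
  finally show ?thesis
    using norm_mean_sq_le[OF n, of ?d] by (simp add: sum_distrib_left)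
qed

abbreviation "sg \<equiv> \<lambda>k \<omega>. \<sigma>sq (\<lambda>i. w i k \<omega>)"
abbreviation "gap \<equiv> \<lambda>k \<omega>. f (x k \<omega>) - f xs"

lemma discrete_sigma_sq:
  assumes "\<And>i. i \<in> {1..n} \<Longrightarrow> discrete_rv M F (w i k)"
  shows "discrete_rv M F (sg k)"
  unfolding lsvrg_sigma_sq_def
  by (rule discrete_rv_map[where h = "\<lambda>s. 1 / (real n * real m) * s"], rule discrete_rv_sum,
      rule discrete_rv_map[OF assms])

lemma discrete_M:
  shows "discrete_rv M M (sg k)" and "discrete_rv M M (gap k)"
    and "discrete_rv M M (\<lambda>\<omega>. gradient f (x k \<omega>))"
    and "discrete_rv M M (\<lambda>\<omega>. (norm (gm k \<omega>))\<^sup>2)"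
proof -
  show "discrete_rv M M (sg k)" by (rule discrete_sigma_sq) (rule trajectory_M)
  show "discrete_rv M M (gap k)" by (rule discrete_rv_map[OF trajectory_M(3)])
  show "discrete_rv M M (\<lambda>\<omega>. gradient f (x k \<omega>))" by (rule discrete_rv_map[OF trajectory_M(3)])
  show "discrete_rv M M (\<lambda>\<omega>. (norm (gm k \<omega>))\<^sup>2)" by (rule discrete_rv_map[OF trajectory_M(6)])
qed

lemma discrete_gm_past:
  assumes "t < k"
  shows "discrete_rv M (H k) (gm t)"
  using trajectory_H(6)[of k k t] assms by auto

lemma discrete_em: "discrete_rv M (H k) (em k)"
proof (rule discrete_rv_cong[OF space_H mean_error_eq])
  show "discrete_rv M (H k) (\<lambda>\<omega>. \<gamma> *\<^sub>R (\<Sum>t\<in>{k - \<tau>..<k}. gm t \<omega>))"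
    by (rule discrete_rv_map, rule discrete_rv_sum, rule discrete_gm_past) auto
qed

lemma discrete_x: "discrete_rv M (H k) (x k)"
  using trajectory_H(3)[of k k k] by auto

lemma discrete_virtual: "discrete_rv M (H k) (virtual k)"
  unfolding virtual_def[abs_def] by (rule discrete_rv_map2[OF discrete_x discrete_em])

lemma cond_exp_norm_gm:
  "AE \<omega> in M. real_cond_exp M (H k) (\<lambda>\<omega>. (norm (gm k \<omega>))\<^sup>2) \<omega> \<le> 4 * L * gap k \<omega> + 2 * sg k \<omega>"
proof -
  define \<psi> where "\<psi> i j u u' =
    1 / real n * (norm (estimator i j u u' - gradient (local_loss m fc i) xs))\<^sup>2" for i j u u'
  have "discrete_rv M M (\<lambda>\<omega>. \<Sum>i=1..n. \<psi> i (idx i k \<omega>) (x k \<omega>) (w i k \<omega>))"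
    by (rule discrete_rv_sum, rule discrete_rv_map3) (auto intro: trajectory_M)
  then have 1: "AE \<omega> in M. real_cond_exp M (H k) (\<lambda>\<omega>. (norm (gm k \<omega>))\<^sup>2) \<omega>
      \<le> real_cond_exp M (H k) (\<lambda>\<omega>. \<Sum>i=1..n. \<psi> i (idx i k \<omega>) (x k \<omega>) (w i k \<omega>)) \<omega>"
    using norm_gm_sq_le unfolding \<psi>_def
    by (intro H.real_cond_exp_mono AE_I2 integrable_M discrete_M) auto
  have 2: "(\<Sum>i=1..n. 1 / real m * (\<Sum>j=1..m. \<psi> i j u (u' i))) \<le> 4 * L * (f u - f xs) + 2 * \<sigma>sq u'"
    for u u'
  proof -
    let ?S = "\<lambda>i. \<Sum>j=1..m. (norm (estimator i j u (u' i) - gradient (local_loss m fc i) xs))\<^sup>2"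
    let ?D = "\<lambda>i z. \<Sum>j=1..m. (norm (gradient (fc i j) z - gradient (fc i j) xs))\<^sup>2"
    have "(\<Sum>i=1..n. 1 / real m * (\<Sum>j=1..m. \<psi> i j u (u' i))) = 1 / (real n * real m) * (\<Sum>i=1..n. ?S i)"
      by (simp add: \<psi>_def sum_distrib_left sum_divide_distrib mult.commute)
    also have "\<dots> \<le> 1 / (real n * real m) * (\<Sum>i=1..n. 2 * ?D i u + 2 * ?D i (u' i))"
      by (intro mult_left_mono sum_mono estimator_second_moment) auto
    also have "\<dots> = 2 * \<sigma>sq (\<lambda>_. u) + 2 * \<sigma>sq u'"
      by (simp add: lsvrg_sigma_sq_def sum.distrib sum_distrib_left distrib_left add_divide_distrib)
    also have "\<dots> \<le> 4 * L * (f u - f xs) + 2 * \<sigma>sq u'"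
      using sigma_sq_const_le[of u] by simp
    finally show ?thesis .
  qed
  from 1 cond_exp_idx[of k \<psi>] show ?thesis
  proof eventually_elim
    case (elim \<omega>)
    show ?case using elim(1) unfolding elim(2) by (rule order_trans[OF _ 2])
  qed
qed

lemma cond_exp_sigma_sq:
  "AE \<omega> in M. real_cond_exp M (H k) (sg (Suc k)) \<omega> \<le> (1 - p) * sg k \<omega> + 2 * (L * p) * gap k \<omega>"
proof -
  define \<psi> where "\<psi> i u = 1 / (real n * real m) *
    (\<Sum>j=1..m. (norm (gradient (fc i j) u - gradient (fc i j) xs))\<^sup>2)" for i u
  have sg: "\<sigma>sq u = (\<Sum>i=1..n. \<psi> i (u i))" for u
    by (simp add: lsvrg_sigma_sq_def \<psi>_def sum_distrib_left)
  have eq: "(\<Sum>i=1..n. p * \<psi> i (x k \<omega>) + (1 - p) * \<psi> i (w i k \<omega>))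
      = p * \<sigma>sq (\<lambda>_. x k \<omega>) + (1 - p) * sg k \<omega>" for \<omega>
    by (simp add: sg sum.distrib sum_distrib_left)
  have "p * \<sigma>sq (\<lambda>_. x k \<omega>) \<le> 2 * (L * p) * gap k \<omega>" for \<omega>
    using mult_left_mono[OF sigma_sq_const_le[of "x k \<omega>"], of p] p by (simp add: algebra_simps)
  then have bound: "p * \<sigma>sq (\<lambda>_. x k \<omega>) + (1 - p) * sg k \<omega>
      \<le> (1 - p) * sg k \<omega> + 2 * (L * p) * gap k \<omega>" for \<omega>
    by (simp add: add.commute)
  have "AE \<omega> in M. real_cond_exp M (H k) (sg (Suc k)) \<omega>
      = p * \<sigma>sq (\<lambda>_. x k \<omega>) + (1 - p) * sg k \<omega>"
    using cond_exp_coin[of k \<psi>] by (simp only: eq sg)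
  then show ?thesis
  proof eventually_elim
    case (elim \<omega>)
    show ?case unfolding elim by (rule bound)
  qed
qed

text \<open>Unbiasedness against any quantity known at iteration \<open>k\<close>, applied below to the virtual iterate
  and to partial sums of the noise.\<close>

lemma expectation_inner_gm:
  assumes U: "discrete_rv M (H k) U"
  shows "expectation (\<lambda>\<omega>. U \<omega> \<bullet> gm k \<omega>) = expectation (\<lambda>\<omega>. U \<omega> \<bullet> gradient f (x k \<omega>))"
proof -
  have UM: "discrete_rv M M U" by (rule discrete_rv_subalgebra[OF subalgebra_H U])
  have one: "expectation (\<lambda>\<omega>. (U \<omega> \<bullet> b) * (gm k \<omega> \<bullet> b))
      = expectation (\<lambda>\<omega>. (U \<omega> \<bullet> b) * (gradient f (x k \<omega>) \<bullet> b))" for b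
  proof -
    have Ub: "(\<lambda>\<omega>. U \<omega> \<bullet> b) \<in> borel_measurable (H k)"
      by (rule discrete_rv_measurable[OF discrete_rv_map[OF U]]) simp
    have gb: "(\<lambda>\<omega>. gm k \<omega> \<bullet> b) \<in> borel_measurable M"
      by (rule discrete_rv_measurable[OF discrete_rv_map[OF trajectory_M(6)]]) simp
    have db: "(\<lambda>\<omega>. (U \<omega> \<bullet> b) * (gradient f (x k \<omega>) \<bullet> b)) \<in> borel_measurable M"
      by (rule discrete_rv_measurable[OF discrete_rv_map2[OF UM trajectory_M(3)]]) simp
    have "integrable M (\<lambda>\<omega>. (U \<omega> \<bullet> b) * (gm k \<omega> \<bullet> b))"
      by (rule integrable_M[OF discrete_rv_map2[OF UM trajectory_M(6)]])
    note R = H.real_cond_exp_intg[OF this Ub gb]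
    have "AE \<omega> in M. (U \<omega> \<bullet> b) * real_cond_exp M (H k) (\<lambda>\<omega>. gm k \<omega> \<bullet> b) \<omega>
        = (U \<omega> \<bullet> b) * (gradient f (x k \<omega>) \<bullet> b)"
      using cond_exp_gm[of k b] by eventually_elim simp
    from integral_cong_AE[OF borel_measurable_integrable[OF R(1)] db this]
    show ?thesis by (simp only: R(2))
  qed
  have int: "integrable M (\<lambda>\<omega>. (U \<omega> \<bullet> b) * (gm k \<omega> \<bullet> b))"
    "integrable M (\<lambda>\<omega>. (U \<omega> \<bullet> b) * (gradient f (x k \<omega>) \<bullet> b))" for b
    by (rule integrable_M[OF discrete_rv_map2[OF UM trajectory_M(6)]],
        rule integrable_M[OF discrete_rv_map2[OF UM trajectory_M(3)]])
  have "expectation (\<lambda>\<omega>. U \<omega> \<bullet> gm k \<omega>) = expectation (\<lambda>\<omega>. \<Sum>b\<in>Basis. (U \<omega> \<bullet> b) * (gm k \<omega> \<bullet> b))"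
    by (rule Bochner_Integration.integral_cong[OF refl euclidean_inner])
  also have "\<dots> = expectation (\<lambda>\<omega>. \<Sum>b\<in>Basis. (U \<omega> \<bullet> b) * (gradient f (x k \<omega>) \<bullet> b))"
    using int one by simp
  also have "\<dots> = expectation (\<lambda>\<omega>. U \<omega> \<bullet> gradient f (x k \<omega>))"
    by (rule Bochner_Integration.integral_cong[OF refl euclidean_inner[symmetric]])
  finally show ?thesis .
qed

lemma expectation_norm_gm:
  "expectation (\<lambda>\<omega>. (norm (gm k \<omega>))\<^sup>2) \<le> 4 * L * expectation (gap k) + 2 * expectation (sg k)"
proof -
  have int: "integrable M (\<lambda>\<omega>. (norm (gm k \<omega>))\<^sup>2)" "integrable M (gap k)" "integrable M (sg k)"
    by (rule integrable_M, rule discrete_M)+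
  have "expectation (\<lambda>\<omega>. (norm (gm k \<omega>))\<^sup>2)
      = expectation (real_cond_exp M (H k) (\<lambda>\<omega>. (norm (gm k \<omega>))\<^sup>2))"
    using H.real_cond_exp_int(2)[OF int(1)] by simp
  also have "\<dots> \<le> expectation (\<lambda>\<omega>. 4 * L * gap k \<omega> + 2 * sg k \<omega>)"
    using H.real_cond_exp_int(1)[OF int(1)] int cond_exp_norm_gm
    by (intro integral_mono_AE) auto
  also have "\<dots> = 4 * L * expectation (gap k) + 2 * expectation (sg k)"
    using int by (subst Bochner_Integration.integral_add) auto
  finally show ?thesis .
qed

lemma expectation_sigma_sq_Suc:
  "expectation (sg (Suc k)) \<le> (1 - p) * expectation (sg k) + 2 * L * p * expectation (gap k)"
proof -
  have int: "integrable M (sg (Suc k))" "integrable M (gap k)" "integrable M (sg k)"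
    by (rule integrable_M, rule discrete_M)+
  have "expectation (sg (Suc k)) = expectation (real_cond_exp M (H k) (sg (Suc k)))"
    using H.real_cond_exp_int(2)[OF int(1)] by simp
  also have "\<dots> \<le> expectation (\<lambda>\<omega>. (1 - p) * sg k \<omega> + 2 * (L * p) * gap k \<omega>)"
    using H.real_cond_exp_int(1)[OF int(1)] int cond_exp_sigma_sq
    by (intro integral_mono_AE) auto
  also have "\<dots> = (1 - p) * expectation (sg k) + 2 * L * p * expectation (gap k)"
    using int by (subst Bochner_Integration.integral_add) (auto simp: mult.assoc)
  finally show ?thesis .
qed

section \<open>The accumulated error\<close>

definition noise :: "nat \<Rightarrow> 'w \<Rightarrow> 'a" where
  "noise t \<omega> = gm t \<omega> - gradient f (x t \<omega>)"

lemma discrete_noise_M: "discrete_rv M M (noise t)"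
  unfolding noise_def[abs_def] by (rule discrete_rv_map2[OF trajectory_M(6) discrete_M(3)])

lemma discrete_noise_past: "t < k \<Longrightarrow> discrete_rv M (H k) (noise t)"
  unfolding noise_def[abs_def]
  by (rule discrete_rv_map2[OF discrete_gm_past], simp, rule discrete_rv_map, rule trajectory_H(3)) auto

text \<open>The conditional variance is the second moment minus the squared norm of the conditional mean.\<close>

lemma expectation_norm_noise:
  "expectation (\<lambda>\<omega>. (norm (noise t \<omega>))\<^sup>2) \<le> expectation (\<lambda>\<omega>. (norm (gm t \<omega>))\<^sup>2)"
proof -
  let ?d = "\<lambda>\<omega>. gradient f (x t \<omega>)"
  have int: "integrable M (\<lambda>\<omega>. (norm (gm t \<omega>))\<^sup>2)" "integrable M (\<lambda>\<omega>. ?d \<omega> \<bullet> gm t \<omega>)"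
    "integrable M (\<lambda>\<omega>. ?d \<omega> \<bullet> ?d \<omega>)"
    by (rule integrable_M[OF discrete_M(4)],
        rule integrable_M[OF discrete_rv_map2[OF discrete_M(3) trajectory_M(6)]],
        rule integrable_M[OF discrete_rv_map[OF trajectory_M(3)]])
  have "expectation (\<lambda>\<omega>. (norm (noise t \<omega>))\<^sup>2)
      = expectation (\<lambda>\<omega>. (norm (gm t \<omega>))\<^sup>2 - 2 * (?d \<omega> \<bullet> gm t \<omega>) + ?d \<omega> \<bullet> ?d \<omega>)"
    by (rule Bochner_Integration.integral_cong)
      (auto simp: noise_def power2_norm_eq_inner inner_diff_left inner_diff_right inner_commute)
  also have "\<dots> = expectation (\<lambda>\<omega>. (norm (gm t \<omega>))\<^sup>2) - 2 * expectation (\<lambda>\<omega>. ?d \<omega> \<bullet> gm t \<omega>)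
      + expectation (\<lambda>\<omega>. ?d \<omega> \<bullet> ?d \<omega>)"
    using int by simp
  also have "\<dots> = expectation (\<lambda>\<omega>. (norm (gm t \<omega>))\<^sup>2) - expectation (\<lambda>\<omega>. ?d \<omega> \<bullet> ?d \<omega>)"
    using expectation_inner_gm[of t ?d] discrete_rv_map[OF discrete_x[of t], of "gradient f"] by simp
  also have "\<dots> \<le> expectation (\<lambda>\<omega>. (norm (gm t \<omega>))\<^sup>2)"
    by simp
  finally show ?thesis .
qed

text \<open>Orthogonality of martingale differences: the cross term of the past noise with the new one has
  mean zero.\<close>

lemma expectation_noise_sum:
  "expectation (\<lambda>\<omega>. (norm (\<Sum>t\<in>{l..<k}. noise t \<omega>))\<^sup>2)
    \<le> (\<Sum>t\<in>{l..<k}. expectation (\<lambda>\<omega>. (norm (gm t \<omega>))\<^sup>2))"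
proof (induction k)
  case 0
  then show ?case by simp
next
  case (Suc k)
  show ?case
  proof (cases "l \<le> k")
    case False
    then show ?thesis by simp
  next
    case True
    define S where "S \<omega> = (\<Sum>t\<in>{l..<k}. noise t \<omega>)" for \<omega>
    have S: "discrete_rv M (H k) S"
      unfolding S_def[abs_def] by (rule discrete_rv_sum, rule discrete_noise_past) auto
    have SM: "discrete_rv M M S" by (rule discrete_rv_subalgebra[OF subalgebra_H S])
    have int: "integrable M (\<lambda>\<omega>. (norm (S \<omega>))\<^sup>2)" "integrable M (\<lambda>\<omega>. S \<omega> \<bullet> gm k \<omega>)"
      "integrable M (\<lambda>\<omega>. S \<omega> \<bullet> gradient f (x k \<omega>))" "integrable M (\<lambda>\<omega>. (norm (noise k \<omega>))\<^sup>2)"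
      by (rule integrable_M[OF discrete_rv_map[OF SM]],
          rule integrable_M[OF discrete_rv_map2[OF SM trajectory_M(6)]],
          rule integrable_M[OF discrete_rv_map2[OF SM trajectory_M(3)]],
          rule integrable_M[OF discrete_rv_map[OF discrete_noise_M]])
    have "expectation (\<lambda>\<omega>. (norm (\<Sum>t\<in>{l..<Suc k}. noise t \<omega>))\<^sup>2)
        = expectation (\<lambda>\<omega>. (norm (S \<omega>))\<^sup>2 + 2 * (S \<omega> \<bullet> gm k \<omega>) - 2 * (S \<omega> \<bullet> gradient f (x k \<omega>))
            + (norm (noise k \<omega>))\<^sup>2)"
    proof (rule Bochner_Integration.integral_cong[OF refl])
      fix \<omega>
      have "(\<Sum>t\<in>{l..<Suc k}. noise t \<omega>) = S \<omega> + noise k \<omega>"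
        unfolding S_def by (rule sum.atLeastLessThan_Suc[OF True])
      then have "(norm (\<Sum>t\<in>{l..<Suc k}. noise t \<omega>))\<^sup>2
          = (norm (S \<omega>))\<^sup>2 + 2 * (S \<omega> \<bullet> noise k \<omega>) + (norm (noise k \<omega>))\<^sup>2"
        by (simp only: power2_norm_eq_inner) (simp add: inner_add_left inner_add_right inner_commute)
      then show "(norm (\<Sum>t\<in>{l..<Suc k}. noise t \<omega>))\<^sup>2 = (norm (S \<omega>))\<^sup>2
          + 2 * (S \<omega> \<bullet> gm k \<omega>) - 2 * (S \<omega> \<bullet> gradient f (x k \<omega>)) + (norm (noise k \<omega>))\<^sup>2"
        by (simp add: noise_def inner_diff_right)
    qed
    also have "\<dots> = expectation (\<lambda>\<omega>. (norm (S \<omega>))\<^sup>2) + expectation (\<lambda>\<omega>. (norm (noise k \<omega>))\<^sup>2)"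
      using int expectation_inner_gm[OF S] by simp
    also have "\<dots> \<le> (\<Sum>t\<in>{l..<k}. expectation (\<lambda>\<omega>. (norm (gm t \<omega>))\<^sup>2))
        + expectation (\<lambda>\<omega>. (norm (gm k \<omega>))\<^sup>2)"
      using Suc.IH expectation_norm_noise[of k] unfolding S_def by (rule add_mono)
    also have "\<dots> = (\<Sum>t\<in>{l..<Suc k}. expectation (\<lambda>\<omega>. (norm (gm t \<omega>))\<^sup>2))"
      by (rule sum.atLeastLessThan_Suc[OF True, symmetric])
    finally show ?thesis .
  qed
qed

text \<open>Only the sum of the gradients is bounded through the window length \<open>\<tau>\<close>; the noise
  enters through the sum of its second moments.\<close>

lemma expectation_error:
  "expectation (\<lambda>\<omega>. (norm (em k \<omega>))\<^sup>2) \<le> 4 * \<gamma>\<^sup>2 *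
    (\<Sum>t\<in>{k - \<tau>..<k}. L * (real \<tau> + 2) * expectation (gap t) + expectation (sg t))"
proof -
  let ?I = "{k - \<tau>..<k}"
  let ?A = "\<lambda>\<omega>. \<Sum>t\<in>?I. gradient f (x t \<omega>)"
  let ?N = "\<lambda>\<omega>. \<Sum>t\<in>?I. noise t \<omega>"
  have int: "integrable M (gap t)" for t by (rule integrable_M, rule discrete_M)
  have intN: "integrable M (\<lambda>\<omega>. (norm (?N \<omega>))\<^sup>2)"
    by (rule integrable_M, rule discrete_rv_map, rule discrete_rv_sum, rule discrete_noise_M)
  have inte: "integrable M (\<lambda>\<omega>. (norm (em k \<omega>))\<^sup>2)"
    by (rule integrable_M, rule discrete_rv_map, rule discrete_rv_subalgebra[OF subalgebra_H discrete_em])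
  have pt: "(norm (em k \<omega>))\<^sup>2 \<le> 2 * \<gamma>\<^sup>2 * (real \<tau> * (\<Sum>t\<in>?I. 2 * L * gap t \<omega>) + (norm (?N \<omega>))\<^sup>2)"
    if "\<omega> \<in> space M" for \<omega>
  proof -
    have A: "(norm (?A \<omega>))\<^sup>2 \<le> real \<tau> * (\<Sum>t\<in>?I. 2 * L * gap t \<omega>)"
    proof -
      have "(norm (?A \<omega>))\<^sup>2 \<le> real (card ?I) * (\<Sum>t\<in>?I. (norm (gradient f (x t \<omega>)))\<^sup>2)"
        by (rule norm_sum_sq_le)
      also have "\<dots> \<le> real \<tau> * (\<Sum>t\<in>?I. 2 * L * gap t \<omega>)"
        by (intro mult_mono sum_mono gradient_sq_le sum_nonneg) auto
      finally show ?thesis .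
    qed
    have "em k \<omega> = \<gamma> *\<^sub>R (?A \<omega> + ?N \<omega>)"
      by (simp add: mean_error_eq[OF that] noise_def sum_subtractf)
    then have "(norm (em k \<omega>))\<^sup>2 = \<gamma>\<^sup>2 * (norm (?A \<omega> + ?N \<omega>))\<^sup>2"
      by (simp add: power_mult_distrib)
    also have "\<dots> \<le> \<gamma>\<^sup>2 * (2 * (norm (?A \<omega>))\<^sup>2 + 2 * (norm (?N \<omega>))\<^sup>2)"
      by (intro mult_left_mono norm_add_sq_le) simp
    also have "\<dots> \<le> \<gamma>\<^sup>2 * (2 * (real \<tau> * (\<Sum>t\<in>?I. 2 * L * gap t \<omega>)) + 2 * (norm (?N \<omega>))\<^sup>2)"
      using A by (intro mult_left_mono) auto
    finally show ?thesis by (simp add: algebra_simps)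
  qed
  have "expectation (\<lambda>\<omega>. (norm (em k \<omega>))\<^sup>2)
      \<le> expectation (\<lambda>\<omega>. 2 * \<gamma>\<^sup>2 * (real \<tau> * (\<Sum>t\<in>?I. 2 * L * gap t \<omega>) + (norm (?N \<omega>))\<^sup>2))"
    using inte int intN pt by (intro integral_mono) auto
  also have "\<dots> = 2 * \<gamma>\<^sup>2 * (real \<tau> * (\<Sum>t\<in>?I. 2 * L * expectation (gap t))
      + expectation (\<lambda>\<omega>. (norm (?N \<omega>))\<^sup>2))"
  proof -
    have "integrable M (\<lambda>\<omega>. real \<tau> * (\<Sum>t\<in>?I. 2 * L * gap t \<omega>))"
      by (intro integrable_mult_right Bochner_Integration.integrable_sum int)
    moreover have "expectation (\<lambda>\<omega>. \<Sum>t\<in>?I. 2 * L * gap t \<omega>) = (\<Sum>t\<in>?I. 2 * L * expectation (gap t))"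
      using int by (subst Bochner_Integration.integral_sum) auto
    ultimately show ?thesis using intN by simp
  qed
  also have "\<dots> \<le> 2 * \<gamma>\<^sup>2 * (real \<tau> * (\<Sum>t\<in>?I. 2 * L * expectation (gap t))
      + (\<Sum>t\<in>?I. 4 * L * expectation (gap t) + 2 * expectation (sg t)))"
    by (intro mult_left_mono add_left_mono order_trans[OF expectation_noise_sum] sum_mono
        expectation_norm_gm) simp
  also have "\<dots> = 4 * \<gamma>\<^sup>2 *
    (\<Sum>t\<in>{k - \<tau>..<k}. L * (real \<tau> + 2) * expectation (gap t) + expectation (sg t))"
    by (simp add: sum_distrib_left sum.distrib[symmetric] algebra_simps)
  finally show ?thesis .
qed

definition \<eta> :: real where "\<eta> = min (\<gamma> * \<mu> / 2) (p / 4)"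

lemma eta_bounds: "0 \<le> \<eta>" "\<eta> \<le> p / 4" "\<eta> < 1 / 4" "\<eta> < 1" "\<eta> \<le> \<gamma> * \<mu> / 2"
  using mu gamma p by (auto simp: \<eta>_def)

lemma gamma_L: "\<gamma> * L \<le> 3 / 56"
proof -
  have "\<gamma> \<le> 3 / (56 * L)" using gamma_le by simp
  then show ?thesis using L by (simp add: field_simps)
qed

text \<open>The factor \<open>\<tau> + 6\<close> arises as \<open>2 + \<tau> + 4\<close>, where \<open>4/(1 - p) \<ge> 4\<close> leaves room for the constant
  \<open>32/9\<close> that the contraction of \<open>\<sigma>\<^sub>k\<^sup>2\<close> contributes in \<open>weighted_error\<close>.\<close>

lemma gamma_tau_sq: "64 * \<gamma>\<^sup>2 * L\<^sup>2 * (real \<tau> * (real \<tau> + 6)) \<le> 1"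
proof -
  define q where "q = real \<tau> * (2 + real \<tau> + 4 / (1 - p))"
  have "1 \<le> 1 / (1 - p)" using p by simp
  then have q: "real \<tau> * (real \<tau> + 6) \<le> q"
    unfolding q_def by (intro mult_left_mono) auto
  then have q0: "0 < q" using tau by (smt (verit) mult_pos_pos of_nat_0_less_iff less_le_trans zero_less_one of_nat_0_le_iff less_numeral_extra(1) One_nat_def Suc_le_lessD)
  have "\<gamma> \<le> 1 / (8 * L * sqrt q)" using gamma_le unfolding q_def by simp
  then have "\<gamma> * (8 * L * sqrt q) \<le> 1" using L q0 by (simp add: field_simps)
  then have "(\<gamma> * (8 * L * sqrt q))\<^sup>2 \<le> 1\<^sup>2"
    using gamma L q0 by (intro power_mono) auto
  then have "64 * \<gamma>\<^sup>2 * L\<^sup>2 * q \<le> 1" using q0 by (simp add: power_mult_distrib)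
  moreover have "64 * \<gamma>\<^sup>2 * L\<^sup>2 * (real \<tau> * (real \<tau> + 6)) \<le> 64 * \<gamma>\<^sup>2 * L\<^sup>2 * q"
    using q by (intro mult_left_mono) auto
  ultimately show ?thesis by linarith
qed

lemma eta_tau: "\<eta> * real \<tau> \<le> 1 / 16"
proof -
  have "(8 * (\<gamma> * L * real \<tau>))\<^sup>2 \<le> 64 * \<gamma>\<^sup>2 * L\<^sup>2 * (real \<tau> * (real \<tau> + 6))"
  proof -
    have "0 \<le> 384 * \<gamma>\<^sup>2 * L\<^sup>2 * real \<tau>" by simp
    then show ?thesis by (simp add: power2_eq_square algebra_simps)
  qed
  then have "(8 * (\<gamma> * L * real \<tau>))\<^sup>2 \<le> 1\<^sup>2" using gamma_tau_sq by simp
  then have *: "8 * (\<gamma> * L * real \<tau>) \<le> 1" by (rule power2_le_imp_le) simp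
  have "\<eta> * real \<tau> \<le> (\<gamma> * L / 2) * real \<tau>"
  proof (intro mult_right_mono)
    show "\<eta> \<le> \<gamma> * L / 2"
    proof -
      have "\<gamma> * \<mu> \<le> \<gamma> * L" using mu_le_L gamma by (intro mult_left_mono) auto
      then show ?thesis using eta_bounds(5) by simp
    qed
  qed simp
  then show ?thesis using * by simp
qed

lemma gap_nonneg: "0 \<le> expectation (gap k)"
  by (rule Bochner_Integration.integral_nonneg) (simp add: global_loss_min)

lemma sg_nonneg: "0 \<le> expectation (sg k)"
  by (rule Bochner_Integration.integral_nonneg) (simp add: sigma_sq_nonneg)

lemma sg_0: "\<omega> \<in> space M \<Longrightarrow> sg 0 \<omega> = \<sigma>sq w0"
  unfolding lsvrg_sigma_sq_def by (intro arg_cong[of _ _ "(*) _"] sum.cong refl) (simp add: w_0)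

lemma expectation_sg_0: "expectation (sg 0) = \<sigma>sq w0"
proof -
  have "expectation (sg 0) = expectation (\<lambda>_. \<sigma>sq w0)"
    by (rule Bochner_Integration.integral_cong) (auto simp: sg_0)
  then show ?thesis by (simp add: prob_space)
qed

definition F2 :: real where "F2 = 12 * \<gamma>\<^sup>2 * L * real \<tau> * (2 + p) / p"

lemma weighted_error:
  "3 * L * (\<Sum>k=0..K. weight \<eta> k * expectation (\<lambda>\<omega>. (norm (em k \<omega>))\<^sup>2))
    \<le> 1 / 4 * (\<Sum>k=0..K. weight \<eta> k * expectation (gap k)) + F2 * \<sigma>sq w0"
proof -
  let ?r = "\<lambda>k. expectation (gap k)" and ?s = "\<lambda>k. expectation (sg k)"
  define R where "R = (\<Sum>k=0..K. weight \<eta> k * ?r k)"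
  define S where "S = (\<Sum>k=0..K. weight \<eta> k * ?s k)"
  define a where "a k = L * (real \<tau> + 2) * ?r k + ?s k" for k
  note eta = eta_bounds
  have w: "0 \<le> weight \<eta> k" for k using weight_pos[OF eta(4)] by (simp add: less_imp_le)
  have R0: "0 \<le> R" unfolding R_def using w gap_nonneg by (intro sum_nonneg) auto
  have a0: "0 \<le> a k" for k
    using L gap_nonneg sg_nonneg by (simp add: a_def)
  have inv: "1 / (1 - \<eta>) \<le> 4 / 3" using eta by (simp add: field_simps)
  have S: "S \<le> 16 / (9 * p) * \<sigma>sq w0 + 32 / 9 * L * R"
  proof -
    have "S \<le> 4 / (3 * p) * (?s 0 / (1 - \<eta>) + 2 * L * p / (1 - \<eta>) * R)"
      unfolding S_def R_def using p L eta sg_nonneg gap_nonneg expectation_sigma_sq_Suc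
      by (intro weighted_sum_contraction) auto
    also have "\<dots> = 4 / (3 * p) * (1 / (1 - \<eta>) * (?s 0 + 2 * L * p * R))"
      by (simp add: add_divide_distrib distrib_left)
    also have "\<dots> \<le> 4 / (3 * p) * (4 / 3 * (?s 0 + 2 * L * p * R))"
      using inv p L R0 sg_nonneg[of 0] by (intro mult_left_mono mult_right_mono) auto
    also have "\<dots> = 16 / (9 * p) * \<sigma>sq w0 + 32 / 9 * L * R"
      using p by (simp add: expectation_sg_0 field_simps)
    finally show ?thesis .
  qed
  have "(\<Sum>k=0..K. weight \<eta> k * expectation (\<lambda>\<omega>. (norm (em k \<omega>))\<^sup>2))
      \<le> (\<Sum>k=0..K. weight \<eta> k * (4 * \<gamma>\<^sup>2 * (\<Sum>t\<in>{k - \<tau>..<k}. a t)))"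
    unfolding a_def by (intro sum_mono mult_left_mono expectation_error w)
  also have "\<dots> = 4 * \<gamma>\<^sup>2 * (\<Sum>k=0..K. weight \<eta> k * (\<Sum>t\<in>{k - \<tau>..<k}. a t))"
    by (simp add: sum_distrib_left mult.left_commute)
  also have "\<dots> \<le> 4 * \<gamma>\<^sup>2 * (16 / 15 * real \<tau> * (\<Sum>k=0..K. weight \<eta> k * a k))"
    by (intro mult_left_mono weighted_sum_window_le a0 eta eta_tau) simp
  also have "(\<Sum>k=0..K. weight \<eta> k * a k) = L * (real \<tau> + 2) * R + S"
    by (simp add: a_def R_def S_def sum.distrib sum_distrib_left distrib_left mult.left_commute)
  finally have "(\<Sum>k=0..K. weight \<eta> k * expectation (\<lambda>\<omega>. (norm (em k \<omega>))\<^sup>2))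
      \<le> 4 * \<gamma>\<^sup>2 * (16 / 15 * real \<tau> * (L * (real \<tau> + 2) * R + S))" .
  also have "\<dots> \<le> 4 * \<gamma>\<^sup>2 * (16 / 15 * real \<tau> * (L * (real \<tau> + 6) * R + 16 / (9 * p) * \<sigma>sq w0))"
  proof (intro mult_left_mono)
    have "32 / 9 * (L * R) \<le> 4 * (L * R)" using L R0 by (intro mult_right_mono) auto
    then show "L * (real \<tau> + 2) * R + S \<le> L * (real \<tau> + 6) * R + 16 / (9 * p) * \<sigma>sq w0"
      using S by (simp add: algebra_simps)
  qed auto
  finally have "3 * L * (\<Sum>k=0..K. weight \<eta> k * expectation (\<lambda>\<omega>. (norm (em k \<omega>))\<^sup>2))
      \<le> 3 * L * (4 * \<gamma>\<^sup>2 * (16 / 15 * real \<tau> * (L * (real \<tau> + 6) * R + 16 / (9 * p) * \<sigma>sq w0)))"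
    using L by (intro mult_left_mono) auto
  \<comment> \<open>\<open>1/5 = 3 * 4 * (16/15) / 64\<close>, where 64 is the square of the 8 in the step size condition\<close>
  also have "\<dots> = 1 / 5 * (64 * \<gamma>\<^sup>2 * L\<^sup>2 * (real \<tau> * (real \<tau> + 6))) * R
      + 1024 / 45 * (\<gamma>\<^sup>2 * L * real \<tau> / p * \<sigma>sq w0)"
    using p by (simp add: field_simps power2_eq_square)
  also have "\<dots> \<le> 1 / 4 * R + F2 * \<sigma>sq w0"
  proof (rule add_mono)
    have "1 / 5 * (64 * \<gamma>\<^sup>2 * L\<^sup>2 * (real \<tau> * (real \<tau> + 6))) \<le> 1 / 4"
      using gamma_tau_sq by linarith
    then show "1 / 5 * (64 * \<gamma>\<^sup>2 * L\<^sup>2 * (real \<tau> * (real \<tau> + 6))) * R \<le> 1 / 4 * R"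
      using R0 by (rule mult_right_mono)
    have "1024 / 45 * (\<gamma>\<^sup>2 * L * real \<tau> / p * \<sigma>sq w0) \<le> (12 * (2 + p)) * (\<gamma>\<^sup>2 * L * real \<tau> / p * \<sigma>sq w0)"
      using p L sigma_sq_nonneg by (intro mult_right_mono) auto
    then show "1024 / 45 * (\<gamma>\<^sup>2 * L * real \<tau> / p * \<sigma>sq w0) \<le> F2 * \<sigma>sq w0"
    proof -
      have "12 * (2 + p) * (\<gamma>\<^sup>2 * L * real \<tau> / p * \<sigma>sq w0) = F2 * \<sigma>sq w0"
        by (simp add: F2_def)
      then show ?thesis using \<open>_ \<le> (12 * (2 + p)) * _\<close> by (simp only:)
    qed
  qed
  finally show ?thesis by (simp add: R_def)
qed

section \<open>Descent of the virtual iterates\<close>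

text \<open>Expanding the square replaces \<open>g\<^sup>k\<close> by \<open>\<nabla>f(x\<^sup>k)\<close> in the cross term. The mismatch
  \<open>\<langle>e\<^sup>k, \<nabla>f(x\<^sup>k)\<rangle>\<close> is split by Young's inequality so that its gradient part costs half of the gap.\<close>

lemma virtual_step:
  "expectation (\<lambda>\<omega>. (norm (virtual (Suc k) \<omega> - xs))\<^sup>2)
    \<le> (1 - \<gamma> * \<mu> / 2) * expectation (\<lambda>\<omega>. (norm (virtual k \<omega> - xs))\<^sup>2)
      - \<gamma> * (1 - 4 * \<gamma> * L) * expectation (gap k)
      + 3 * L * \<gamma> * expectation (\<lambda>\<omega>. (norm (em k \<omega>))\<^sup>2) + 2 * \<gamma>\<^sup>2 * expectation (sg k)"
proof -
  let ?A = "\<lambda>\<omega>. (norm (virtual k \<omega> - xs))\<^sup>2"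
  let ?G = "\<lambda>\<omega>. (virtual k \<omega> - xs) \<bullet> gm k \<omega>" and ?D = "\<lambda>\<omega>. (virtual k \<omega> - xs) \<bullet> gradient f (x k \<omega>)"
  have U: "discrete_rv M (H k) (\<lambda>\<omega>. virtual k \<omega> - xs)" by (rule discrete_rv_map[OF discrete_virtual])
  have UM: "discrete_rv M M (\<lambda>\<omega>. virtual k \<omega> - xs)" by (rule discrete_rv_subalgebra[OF subalgebra_H U])
  have eM: "discrete_rv M M (em k)" by (rule discrete_rv_subalgebra[OF subalgebra_H discrete_em])
  have int: "integrable M ?A" "integrable M ?G" "integrable M ?D"
    "integrable M (\<lambda>\<omega>. (norm (gm k \<omega>))\<^sup>2)" "integrable M (\<lambda>\<omega>. (norm (em k \<omega>))\<^sup>2)" "integrable M (gap k)"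
    by (rule integrable_M[OF discrete_rv_map[OF UM]],
        rule integrable_M[OF discrete_rv_map2[OF UM trajectory_M(6)]],
        rule integrable_M[OF discrete_rv_map2[OF UM trajectory_M(3)]],
        rule integrable_M[OF discrete_M(4)], rule integrable_M[OF discrete_rv_map[OF eM]],
        rule integrable_M[OF discrete_M(2)])
  have pt: "- 2 * \<gamma> * ?D \<omega> \<le> - (\<gamma> * \<mu> / 2) * ?A \<omega> - \<gamma> * gap k \<omega> + 3 * L * \<gamma> * (norm (em k \<omega>))\<^sup>2" for \<omega>
  proof -
    define d where "d = gradient f (x k \<omega>)"
    have 1: "gap k \<omega> + \<mu> / 2 * (norm (x k \<omega> - xs))\<^sup>2 \<le> (x k \<omega> - xs) \<bullet> d"
      using quasi_strong_convexity[of "x k \<omega>"] by (simp add: d_def inner_commute)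
    have "?A \<omega> \<le> 2 * (norm (x k \<omega> - xs))\<^sup>2 + 2 * (norm (em k \<omega>))\<^sup>2"
      using norm_add_sq_le[of "x k \<omega> - xs" "- em k \<omega>"] by (simp add: virtual_def algebra_simps)
    then have 2: "\<mu> / 4 * ?A \<omega> \<le> \<mu> / 2 * (norm (x k \<omega> - xs))\<^sup>2 + \<mu> / 2 * (norm (em k \<omega>))\<^sup>2"
    proof -
      have "\<mu> / 4 * ?A \<omega> \<le> \<mu> / 4 * (2 * (norm (x k \<omega> - xs))\<^sup>2 + 2 * (norm (em k \<omega>))\<^sup>2)"
        using \<open>?A \<omega> \<le> _\<close> mu by (intro mult_left_mono) auto
      then show ?thesis by (simp add: distrib_left)
    qed
    have 3: "em k \<omega> \<bullet> d \<le> L * (norm (em k \<omega>))\<^sup>2 + gap k \<omega> / 2"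
    proof -
      \<comment> \<open>Young's inequality with parameter \<open>2L\<close>, which matches the constant of \<open>gradient_sq_le\<close>\<close>
      have "0 \<le> (norm ((2 * L) *\<^sub>R em k \<omega> - d))\<^sup>2" by simp
      also have "\<dots> = 4 * L\<^sup>2 * (norm (em k \<omega>))\<^sup>2 - 4 * L * (em k \<omega> \<bullet> d) + (norm d)\<^sup>2"
        unfolding power2_norm_eq_inner
        by (simp add: inner_diff_left inner_diff_right inner_commute power2_eq_square algebra_simps)
      also have "\<dots> \<le> 4 * L\<^sup>2 * (norm (em k \<omega>))\<^sup>2 - 4 * L * (em k \<omega> \<bullet> d) + 2 * L * gap k \<omega>"
        using gradient_sq_le[of "x k \<omega>"] by (simp add: d_def)
      finally have "4 * L * (em k \<omega> \<bullet> d) \<le> 4 * L * (L * (norm (em k \<omega>))\<^sup>2 + gap k \<omega> / 2)"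
        by (simp add: power2_eq_square algebra_simps diff_divide_distrib)
      then show ?thesis using L by simp
    qed
    have 4: "\<mu> * (norm (em k \<omega>))\<^sup>2 \<le> L * (norm (em k \<omega>))\<^sup>2"
      using mu_le_L by (intro mult_right_mono) auto
    have "(virtual k \<omega> - xs) \<bullet> d = (x k \<omega> - xs) \<bullet> d - em k \<omega> \<bullet> d"
      by (simp add: virtual_def inner_diff_left)
    then have "\<mu> / 4 * ?A \<omega> + gap k \<omega> / 2 - 3 / 2 * (L * (norm (em k \<omega>))\<^sup>2) \<le> (virtual k \<omega> - xs) \<bullet> d"
      using 1 2 3 4 by argo
    from mult_left_mono[OF this, of "2 * \<gamma>"] gamma show ?thesis
      by (simp add: d_def algebra_simps diff_divide_distrib)
  qed
  have "expectation (\<lambda>\<omega>. (norm (virtual (Suc k) \<omega> - xs))\<^sup>2)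
      = expectation (\<lambda>\<omega>. ?A \<omega> - 2 * \<gamma> * ?G \<omega> + \<gamma>\<^sup>2 * (norm (gm k \<omega>))\<^sup>2)"
  proof (rule Bochner_Integration.integral_cong[OF refl])
    fix \<omega> assume "\<omega> \<in> space M"
    then have "virtual (Suc k) \<omega> - xs = (virtual k \<omega> - xs) - \<gamma> *\<^sub>R gm k \<omega>" by (simp add: virtual_Suc)
    then show "(norm (virtual (Suc k) \<omega> - xs))\<^sup>2 = ?A \<omega> - 2 * \<gamma> * ?G \<omega> + \<gamma>\<^sup>2 * (norm (gm k \<omega>))\<^sup>2"
      by (simp only: norm_diff_scaleR_sq)
  qed
  also have "\<dots> = expectation ?A - 2 * \<gamma> * expectation ?D + \<gamma>\<^sup>2 * expectation (\<lambda>\<omega>. (norm (gm k \<omega>))\<^sup>2)"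
    using int expectation_inner_gm[OF U] by simp
  also have "\<dots> \<le> expectation ?A
      + (- (\<gamma> * \<mu> / 2) * expectation ?A - \<gamma> * expectation (gap k)
          + 3 * L * \<gamma> * expectation (\<lambda>\<omega>. (norm (em k \<omega>))\<^sup>2))
      + \<gamma>\<^sup>2 * (4 * L * expectation (gap k) + 2 * expectation (sg k))"
  proof -
    have i: "integrable M (\<lambda>\<omega>. - (\<gamma> * \<mu> / 2) * ?A \<omega>)" "integrable M (\<lambda>\<omega>. \<gamma> * gap k \<omega>)"
      "integrable M (\<lambda>\<omega>. 3 * L * \<gamma> * (norm (em k \<omega>))\<^sup>2)"
      by (intro integrable_mult_right int)+
    have "expectation (\<lambda>\<omega>. - 2 * \<gamma> * ?D \<omega>) \<le> expectation (\<lambda>\<omega>. - (\<gamma> * \<mu> / 2) * ?A \<omega>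
        - \<gamma> * gap k \<omega> + 3 * L * \<gamma> * (norm (em k \<omega>))\<^sup>2)"
      by (rule integral_mono)
        (intro Bochner_Integration.integrable_add Bochner_Integration.integrable_diff
          integrable_mult_right int pt)+
    also have "\<dots> = - (\<gamma> * \<mu> / 2) * expectation ?A - \<gamma> * expectation (gap k)
          + 3 * L * \<gamma> * expectation (\<lambda>\<omega>. (norm (em k \<omega>))\<^sup>2)"
      by (simp only: Bochner_Integration.integral_add[OF Bochner_Integration.integrable_diff[OF i(1,2)] i(3)]
          Bochner_Integration.integral_diff[OF i(1,2)] integral_mult_right_zero)
    finally have "- 2 * \<gamma> * expectation ?D \<le> \<dots>" using int by simp
    moreover have "\<gamma>\<^sup>2 * expectation (\<lambda>\<omega>. (norm (gm k \<omega>))\<^sup>2)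
        \<le> \<gamma>\<^sup>2 * (4 * L * expectation (gap k) + 2 * expectation (sg k))"
      by (intro mult_left_mono expectation_norm_gm) simp
    ultimately show ?thesis by linarith
  qed
  also have "\<dots> = (1 - \<gamma> * \<mu> / 2) * expectation ?A - \<gamma> * (1 - 4 * \<gamma> * L) * expectation (gap k)
      + 3 * L * \<gamma> * expectation (\<lambda>\<omega>. (norm (em k \<omega>))\<^sup>2) + 2 * \<gamma>\<^sup>2 * expectation (sg k)"
    by (simp add: algebra_simps power2_eq_square)
  finally show ?thesis .
qed

definition T :: "nat \<Rightarrow> real" where
  "T k = expectation (\<lambda>\<omega>. (norm (virtual k \<omega> - xs))\<^sup>2) + 8 / (3 * p) * \<gamma>\<^sup>2 * expectation (sg k)"

lemma T_nonneg: "0 \<le> T k"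
  using p sg_nonneg by (simp add: T_def)

lemma T_0: "T 0 = (norm (x0 - xs))\<^sup>2 + 8 / (3 * p) * \<gamma>\<^sup>2 * \<sigma>sq w0"
proof -
  have "expectation (\<lambda>\<omega>. (norm (virtual 0 \<omega> - xs))\<^sup>2) = expectation (\<lambda>_. (norm (x0 - xs))\<^sup>2)"
    by (rule Bochner_Integration.integral_cong) (auto simp: virtual_def x_0 mean_error_eq)
  then show ?thesis by (simp add: T_def expectation_sg_0 prob_space)
qed

text \<open>The coefficient \<open>8/(3p)\<close> is the one for which the variance term \<open>2\<gamma>\<^sup>2\<sigma>\<^sub>k\<^sup>2\<close> uses up three quarters
  of the contraction of \<open>\<sigma>\<^sub>k\<^sup>2\<close>, leaving the factor \<open>1 - p/4\<close>. The condition \<open>\<gamma>L \<le> 3/56\<close> is exactly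
  what keeps half of the gap: \<open>1 - (28/3)\<gamma>L \<ge> 1/2\<close>.\<close>

lemma T_step:
  "T (Suc k) \<le> (1 - \<eta>) * T k
    - (\<gamma> / 2 * expectation (gap k) - 3 * L * \<gamma> * expectation (\<lambda>\<omega>. (norm (em k \<omega>))\<^sup>2))"
proof -
  define A where "A = expectation (\<lambda>\<omega>. (norm (virtual k \<omega> - xs))\<^sup>2)"
  define r where "r = expectation (gap k)"
  define s where "s = expectation (sg k)"
  define E where "E = expectation (\<lambda>\<omega>. (norm (em k \<omega>))\<^sup>2)"
  define N where "N = 8 / (3 * p) * \<gamma>\<^sup>2"
  have N0: "0 \<le> N" using p by (simp add: N_def)
  have Np: "N * p = 8 / 3 * \<gamma>\<^sup>2" using p by (simp add: N_def)
  have r0: "0 \<le> r" and s0: "0 \<le> s" and A0: "0 \<le> A"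
    by (auto simp: r_def s_def A_def gap_nonneg sg_nonneg)
  have "T (Suc k) \<le> ((1 - \<gamma> * \<mu> / 2) * A - \<gamma> * (1 - 4 * \<gamma> * L) * r + 3 * L * \<gamma> * E + 2 * \<gamma>\<^sup>2 * s)
      + N * ((1 - p) * s + 2 * L * p * r)"
    unfolding T_def A_def r_def s_def E_def N_def[symmetric]
    by (intro add_mono virtual_step mult_left_mono expectation_sigma_sq_Suc N0)
  also have "\<dots> = (1 - \<gamma> * \<mu> / 2) * A + (1 - p / 4) * (N * s)
      - \<gamma> * (1 - 28 / 3 * (\<gamma> * L)) * r + 3 * L * \<gamma> * E"
  proof -
    have a: "N * (1 - p) * s + 2 * \<gamma>\<^sup>2 * s = (1 - p / 4) * (N * s)"
    proof -
      have "2 * \<gamma>\<^sup>2 = 3 / 4 * (N * p)" by (simp add: Np)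
      then show ?thesis by (simp add: algebra_simps)
    qed
    have b: "N * (2 * L * p * r) = 16 / 3 * (\<gamma>\<^sup>2 * L * r)"
    proof -
      have "N * (2 * L * p * r) = (N * p) * (2 * L * r)" by simp
      then show ?thesis by (simp add: Np)
    qed
    have "\<gamma> * (1 - 4 * \<gamma> * L) * r = \<gamma> * r - 4 * (\<gamma>\<^sup>2 * L * r)"
      and "\<gamma> * (1 - 28 / 3 * (\<gamma> * L)) * r = \<gamma> * r - 28 / 3 * (\<gamma>\<^sup>2 * L * r)"
      and "N * ((1 - p) * s + 2 * L * p * r) = N * (1 - p) * s + N * (2 * L * p * r)"
      by (simp_all add: algebra_simps power2_eq_square)
    with a b show ?thesis by linarith
  qed
  also have "\<dots> \<le> (1 - \<eta>) * A + (1 - \<eta>) * (N * s) - \<gamma> / 2 * r + 3 * L * \<gamma> * E"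
  proof -
    have "(1 - \<gamma> * \<mu> / 2) * A \<le> (1 - \<eta>) * A" using eta_bounds A0 by (intro mult_right_mono) auto
    moreover have "(1 - p / 4) * (N * s) \<le> (1 - \<eta>) * (N * s)"
      using eta_bounds N0 s0 by (intro mult_right_mono) auto
    moreover have "\<gamma> * (1 / 2) * r \<le> \<gamma> * (1 - 28 / 3 * (\<gamma> * L)) * r"
      using gamma gamma_L r0 by (intro mult_right_mono mult_left_mono) auto
    ultimately show ?thesis by simp
  qed
  also have "\<dots> = (1 - \<eta>) * T k - (\<gamma> / 2 * r - 3 * L * \<gamma> * E)"
    by (simp add: T_def A_def s_def N_def algebra_simps)
  finally show ?thesis by (simp add: r_def E_def)
qed

lemma weighted_gap_sum:
  "(\<Sum>k=0..K. weight \<eta> k * expectation (gap k)) \<le> 4 * (T 0 + \<gamma> * F2 * \<sigma>sq w0) / \<gamma>"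
proof -
  define R where "R = (\<Sum>k=0..K. weight \<eta> k * expectation (gap k))"
  define E where "E = (\<Sum>k=0..K. weight \<eta> k * expectation (\<lambda>\<omega>. (norm (em k \<omega>))\<^sup>2))"
  have "(\<Sum>k=0..K. weight \<eta> k * (\<gamma> / 2 * expectation (gap k)
      - 3 * L * \<gamma> * expectation (\<lambda>\<omega>. (norm (em k \<omega>))\<^sup>2))) \<le> T 0"
    by (rule weighted_descent[where T = T]) (rule T_nonneg eta_bounds(4) T_step)+
  also have "(\<Sum>k=0..K. weight \<eta> k * (\<gamma> / 2 * expectation (gap k)
      - 3 * L * \<gamma> * expectation (\<lambda>\<omega>. (norm (em k \<omega>))\<^sup>2))) = \<gamma> / 2 * R - \<gamma> * (3 * L * E)"
    by (simp add: R_def E_def sum_distrib_left sum_subtractf[symmetric] right_diff_distrib mult_ac)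
  finally have "\<gamma> / 2 * R - \<gamma> * (3 * L * E) \<le> T 0" .
  moreover have "\<gamma> * (3 * L * E) \<le> \<gamma> * (1 / 4 * R + F2 * \<sigma>sq w0)"
    using weighted_error[of K] gamma unfolding R_def E_def by (intro mult_left_mono) auto
  ultimately have "R * \<gamma> \<le> 4 * (T 0 + \<gamma> * F2 * \<sigma>sq w0)" by (simp add: algebra_simps)
  then show ?thesis using gamma by (simp add: R_def pos_le_divide_eq)
qed

abbreviation "xbar \<equiv> weighted_iterate \<eta> x"

lemma weight_sum_pos: "0 < weight_sum \<eta> K"
  unfolding weight_sum_def using weight_pos[OF eta_bounds(4)] by (intro sum_pos) auto

lemma integrable_xbar: "integrable M (\<lambda>\<omega>. f (xbar K \<omega>) - f xs)"
  unfolding weighted_iterate_def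
  by (rule integrable_M, rule discrete_rv_map[where h = "\<lambda>s. f ((1 / weight_sum \<eta> K) *\<^sub>R s) - f xs"],
      rule discrete_rv_sum, rule discrete_rv_map[OF trajectory_M(3)])

lemma expectation_xbar:
  "expectation (\<lambda>\<omega>. f (xbar K \<omega>) - f xs)
    \<le> 1 / weight_sum \<eta> K * (4 * (T 0 + \<gamma> * F2 * \<sigma>sq w0) / \<gamma>)"
proof -
  let ?W = "weight_sum \<eta> K"
  have int: "integrable M (gap k)" for k by (rule integrable_M, rule discrete_M)
  have one: "(\<Sum>k=0..K. weight \<eta> k / ?W) = 1"
    using weight_sum_pos[of K] by (simp add: weight_sum_def sum_divide_distrib[symmetric])
  have "f (xbar K \<omega>) - f xs \<le> (\<Sum>k=0..K. weight \<eta> k / ?W * gap k \<omega>)" for \<omega>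
  proof -
    have "xbar K \<omega> = (\<Sum>k=0..K. (weight \<eta> k / ?W) *\<^sub>R x k \<omega>)"
      by (simp add: weighted_iterate_def scaleR_sum_right)
    also have "f \<dots> \<le> (\<Sum>k=0..K. weight \<eta> k / ?W * f (x k \<omega>))"
      using weight_pos[OF eta_bounds(4)] weight_sum_pos[of K]
      by (intro convex_on_sum[OF _ _ global_loss_convex one]) (auto simp: less_imp_le)
    finally have "f (xbar K \<omega>) - f xs
        \<le> (\<Sum>k=0..K. weight \<eta> k / ?W * f (x k \<omega>)) - (\<Sum>k=0..K. weight \<eta> k / ?W) * f xs"
      by (simp add: one)
    also have "\<dots> = (\<Sum>k=0..K. weight \<eta> k / ?W * gap k \<omega>)"
      by (simp add: sum_distrib_right sum_subtractf right_diff_distrib)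
    finally show ?thesis .
  qed
  then have "expectation (\<lambda>\<omega>. f (xbar K \<omega>) - f xs) \<le> expectation (\<lambda>\<omega>. \<Sum>k=0..K. weight \<eta> k / ?W * gap k \<omega>)"
    using integrable_xbar int
    by (intro integral_mono Bochner_Integration.integrable_sum integrable_mult_right) auto
  also have "\<dots> = (\<Sum>k=0..K. weight \<eta> k / ?W * expectation (gap k))"
    using int by (subst Bochner_Integration.integral_sum) auto
  also have "\<dots> = 1 / ?W * (\<Sum>k=0..K. weight \<eta> k * expectation (gap k))"
    by (simp add: sum_distrib_left)
  also have "\<dots> \<le> 1 / ?W * (4 * (T 0 + \<gamma> * F2 * \<sigma>sq w0) / \<gamma>)"
    using weight_sum_pos[of K] by (intro mult_left_mono weighted_gap_sum) auto
  finally show ?thesis .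
qed

lemma bound_nonneg: "0 \<le> 4 * (T 0 + \<gamma> * F2 * \<sigma>sq w0) / \<gamma>"
  using T_nonneg[of 0] gamma p L sigma_sq_nonneg[of w0] by (simp add: F2_def)

lemma linear_rate:
  "expectation (\<lambda>\<omega>. f (xbar K \<omega>) - f xs) \<le> (1 - \<eta>) ^ K * (4 * (T 0 + \<gamma> * F2 * \<sigma>sq w0) / \<gamma>)"
proof -
  have "1 / weight_sum \<eta> K \<le> 1 / (1 / (1 - \<eta>) ^ K)"
    using weight_sum_ge[OF eta_bounds(1,4), of K] eta_bounds(4) weight_sum_pos[of K] by (intro divide_left_mono) auto
  then have "1 / weight_sum \<eta> K * (4 * (T 0 + \<gamma> * F2 * \<sigma>sq w0) / \<gamma>)
      \<le> (1 - \<eta>) ^ K * (4 * (T 0 + \<gamma> * F2 * \<sigma>sq w0) / \<gamma>)"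
    using bound_nonneg by (intro mult_right_mono) auto
  then show ?thesis using expectation_xbar[of K] by linarith
qed

lemma sublinear_rate:
  assumes "\<mu> = 0" and "K \<ge> 1"
  shows "expectation (\<lambda>\<omega>. f (xbar K \<omega>) - f xs) \<le> 4 * (T 0 + \<gamma> * F2 * \<sigma>sq w0) / (\<gamma> * real K)"
proof -
  have "\<eta> = 0" unfolding \<eta>_def using assms(1) p by simp
  then have "1 / weight_sum \<eta> K \<le> 1 / real K"
    using assms(2) by (simp add: weight_sum_0 frac_le)
  then have "1 / weight_sum \<eta> K * (4 * (T 0 + \<gamma> * F2 * \<sigma>sq w0) / \<gamma>)
      \<le> 1 / real K * (4 * (T 0 + \<gamma> * F2 * \<sigma>sq w0) / \<gamma>)"
    using bound_nonneg by (intro mult_right_mono)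
  then show ?thesis using expectation_xbar[of K] by (simp add: mult.commute)
qed

definition c :: parametric_constants where
  "c = \<lparr>cA = 2 * L, cB1 = 0, cB2 = 2, cD1 = 0, crho1 = 1, crho2 = p,
        cC1 = 0, cC2 = L * p, cD2 = 0, cG = 0, cF1 = 0, cF2 = F2, cD3 = 0\<rparr>"

lemma eta_c: "eta \<gamma> \<mu> c = \<eta>"
  using p by (simp add: eta_def c_def \<eta>_def min_def)

lemma parametric_assumption_holds: "parametric_assumption M H f xs L \<mu> \<gamma> c x gm em (\<lambda>k \<omega>. 0) sg"
  unfolding parametric_assumption_def eta_c
proof (intro conjI allI)
  fix k K
  show "subalgebra M (H k)" by (rule subalgebra_H)
  show "integrable M (gm k)" by (rule integrable_M[OF trajectory_M(6)])
  show "integrable M (\<lambda>\<omega>. (norm (gm k \<omega>))\<^sup>2)" by (rule integrable_M[OF discrete_M(4)])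
  show "integrable M (\<lambda>\<omega>. (norm (em k \<omega>))\<^sup>2)"
    by (rule integrable_M[OF discrete_rv_map[OF discrete_rv_subalgebra[OF subalgebra_H discrete_em]]])
  show "integrable M (gap k)" by (rule integrable_M[OF discrete_M(2)])
  show "integrable M (\<lambda>\<omega>. 0)" by simp
  show "integrable M (sg k)" by (rule integrable_M[OF discrete_M(1)])
  show "AE \<omega> in M. vec_cond_exp M (H k) (gm k) \<omega> = gradient f (x k \<omega>)" by (rule vec_cond_exp_gm)
  show "AE \<omega> in M. real_cond_exp M (H k) (\<lambda>\<omega>. (norm (gm k \<omega>))\<^sup>2) \<omega>
      \<le> 2 * cA c * gap k \<omega> + cB1 c * 0 + cB2 c * sg k \<omega> + cD1 c"
    using cond_exp_norm_gm[of k] by (simp add: c_def)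
  have "AE \<omega> in M. real_cond_exp M (H k) (\<lambda>\<omega>. 0) \<omega> = 0"
    by (rule H.real_cond_exp_F_meas) auto
  then show "AE \<omega> in M. real_cond_exp M (H k) (\<lambda>\<omega>. 0) \<omega>
      \<le> (1 - crho1 c) * 0 + 2 * cC1 c * gap k \<omega> + cG c * crho1 c * sg k \<omega> + cD2 c"
    by eventually_elim (simp add: c_def)
  show "AE \<omega> in M. real_cond_exp M (H k) (sg (Suc k)) \<omega>
      \<le> (1 - crho2 c) * sg k \<omega> + 2 * cC2 c * gap k \<omega>"
    using cond_exp_sigma_sq[of k] by (simp add: c_def)
  show "AE \<omega> in M. 3 * L * (\<Sum>k=0..K. weight \<eta> k * expectation (\<lambda>\<omega>. (norm (em k \<omega>))\<^sup>2))
      \<le> 1 / 4 * (\<Sum>k=0..K. weight \<eta> k * expectation (gap k))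
        + cF1 c * 0 + cF2 c * sg 0 \<omega> + \<gamma> * cD3 c * weight_sum \<eta> K"
    by (rule AE_I2) (use weighted_error[of K] sg_0 in \<open>simp add: c_def\<close>)
qed

end

theorem theoremK6:
  fixes M :: "'w measure"
    and fc :: "nat \<Rightarrow> nat \<Rightarrow> 'a::euclidean_space \<Rightarrow> real"
    and n m \<tau> :: nat and L \<mu> \<gamma> p :: real
    and x0 xs :: 'a and w0 :: "nat \<Rightarrow> 'a"
    and idx :: "nat \<Rightarrow> nat \<Rightarrow> 'w \<Rightarrow> nat" and coin :: "nat \<Rightarrow> nat \<Rightarrow> 'w \<Rightarrow> bool"
    and x :: "nat \<Rightarrow> 'w \<Rightarrow> 'a" and w g v e :: "nat \<Rightarrow> nat \<Rightarrow> 'w \<Rightarrow> 'a"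
  assumes "n \<ge> 1" and "m \<ge> 1" and "L > 0" and "\<mu> \<ge> 0"
    and "quasi_strongly_convex \<mu> (global_loss n m fc) xs"
    and "\<And>i j. i \<in> {1..n} \<Longrightarrow> j \<in> {1..m} \<Longrightarrow> convex_on UNIV (fc i j)"
    and "\<And>i j. i \<in> {1..n} \<Longrightarrow> j \<in> {1..m} \<Longrightarrow> L_smooth L (fc i j)"
    and "\<tau> \<ge> 1" and "0 < p" and "p < 1" and "0 < \<gamma>"
    and "\<gamma> \<le> min (3 / (56 * L))
               (1 / (8 * L * sqrt (real \<tau> * (2 + real \<tau> + 4 / (1 - p)))))"
    and "dlsvrg M n m fc \<tau> \<gamma> p x0 w0 idx coin x w g v e"
  shows
    "let f = global_loss n m fc;
         c = \<lparr>cA = 2 * L, cB1 = 0, cB2 = 2, cD1 = 0, crho1 = 1, crho2 = p,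
              cC1 = 0, cC2 = L * p, cD2 = 0, cG = 0, cF1 = 0,
              cF2 = 12 * \<gamma>\<^sup>2 * L * real \<tau> * (2 + p) / p, cD3 = 0\<rparr>;
         M2 = 8 / (3 * p);
         sigma0_sq = lsvrg_sigma_sq n m fc xs w0;
         T0 = (norm (x0 - xs))\<^sup>2 + M2 * \<gamma>\<^sup>2 * sigma0_sq;
         xbar = weighted_iterate (eta \<gamma> \<mu> c) x
     in parametric_assumption M (history M n x idx coin) f xs L \<mu> \<gamma> c x
          (worker_mean n g) (worker_mean n e)
          (\<lambda>k \<omega>. 0) (\<lambda>k \<omega>. lsvrg_sigma_sq n m fc xs (\<lambda>i. w i k \<omega>)) \<and>
        (\<forall>K. integrable M (\<lambda>\<omega>. f (xbar K \<omega>) - f xs)) \<and>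
        (\<mu> > 0 \<longrightarrow> (\<forall>K. (\<integral>\<omega>. (f (xbar K \<omega>) - f xs) \<partial>M)
            \<le> (1 - min (\<gamma> * \<mu> / 2) (p / 4)) ^ K * (4 * (T0 + \<gamma> * cF2 c * sigma0_sq) / \<gamma>))) \<and>
        (\<mu> = 0 \<longrightarrow> (\<forall>K\<ge>1. (\<integral>\<omega>. (f (xbar K \<omega>) - f xs) \<partial>M)
            \<le> 4 * (T0 + \<gamma> * cF2 c * sigma0_sq) / (\<gamma> * real K)))"
proof -
  interpret run: dlsvrg_run fc n m L \<mu> xs M \<tau> \<gamma> p x0 w0 idx coin x w g v e
  proof (intro dlsvrg_run.intro finite_sum_problem.intro dlsvrg_run_axioms.intro)
    show "prob_space M" using assms(13) unfolding dlsvrg_def fresh_randomness_def by blast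
  qed (fact assms)+
  have c: "\<lparr>cA = 2 * L, cB1 = 0, cB2 = 2, cD1 = 0, crho1 = 1, crho2 = p, cC1 = 0, cC2 = L * p,
      cD2 = 0, cG = 0, cF1 = 0, cF2 = 12 * \<gamma>\<^sup>2 * L * real \<tau> * (2 + p) / p, cD3 = 0\<rparr> = run.c"
    by (simp add: run.c_def run.F2_def)
  have F2: "cF2 run.c = run.F2" by (simp add: run.c_def)
  show ?thesis
    unfolding Let_def c F2 run.eta_c run.T_0[symmetric] run.\<eta>_def[symmetric]
    using run.parametric_assumption_holds run.integrable_xbar run.linear_rate run.sublinear_rate by blast
qed

end
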